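(* Let $\mathbf G$ be an indexing category, let $\mathcal X,\mathcal Y\in\mathrm{Prob}\langle\mathbf G\rangle$ be two $\mathbf G$-diagrams of probability spaces, and let $U:=X_\iota$ and $V:=Y_\iota$ be the spaces in $\mathcal X$ and $\mathcal Y$, respectively, indexed by some object $\iota\in\mathbf G$. Then $$\boldsymbol\kappa\big([\mathcal X|U],[\mathcal Y|V]\big)\le(2|\mathbf G|+1)\cdot\mathbf k(\mathcal X,\mathcal Y),$$ where $|\mathbf G|$ is the number of objects of $\mathbf G$.
   Context: Finite probability spaces: a finite probability space is a set with a probability measure of finite support. An atom is a point of positive weight; $u\in U$ means that $u$ is an atom of $U$, and $p(u)$ is its weight. A reduction is a measure-preserving map, two maps being identified if they agree on a set of full measure. $\mathrm{Prob}$ is the category of finite probability spaces and reductions. Indexing category: a finite category $\mathbf G$ in which for any two objects $i,j$ there is at most one morphism between them either way, and such that any two objects have a minimal common ancestor. Here $i$ is an ancestor of $j$ if there is a morphism $i\to j$, and a minimal common ancestor of $i,j$ is a common ancestor $\hat\imath$ such that every common ancestor of $i,j$ is an ancestor of $\hat\imath$. Such a category has an initial object. Diagrams: a $\mathbf G$-diagram is a functor $\mathcal X=\{X_i;\chi_{ij}\}:\mathbf G\to\mathrm{Prob}$; a reduction of $\mathbf G$-diagrams is a natural transformation; $\mathrm{Prob}\langle\mathbf G\rangle$ is the category of $\mathbf G$-diagrams. The tensor product $\mathcal X\otimes\mathcal Y$ is taken objectwise (product of probability spaces with product measure, product of maps), and $\mathcal X^n$ is the $n$-fold tensor power. Conditioning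 on an atom: let $X_0=(S_0,\pi_0)$ be the initial space of $\mathcal X$ and $U=X_\iota$, with map $\sigma:S_0\to S_\iota$. For an atom $u\in U$, $\mathcal X|u$ is the $\mathbf G$-diagram with the same underlying sets and maps, whose initial space carries the distribution $\pi_0(\cdot|u)$ supported on $\sigma^{-1}(u)$ with $\pi_0(s|u)=\pi_0(s)/\pi_0(\sigma^{-1}(u))$, and whose other spaces carry the push-forwards of this distribution. Entropy distance: $\mathrm{Ent}_*(\mathcal X)=(\mathrm{Ent}(X_i))_{i\in\mathbf G}\in\mathbb R^{\mathbf G}$ is the tuple of Shannon entropies, and $\|\cdot\|_1$ is the $\ell^1$-norm on $\mathbb R^{\mathbf G}$. For a fan $\mathcal K=(\mathcal X\leftarrow\mathcal Z\to\mathcal Y)$ of reductions of $\mathbf G$-diagrams, $\mathrm{kd}(\mathcal K)=\|\mathrm{Ent}_*\mathcal Z-\mathrm{Ent}_*\mathcal X\|_1+\|\mathrm{Ent}_*\mathcal Z-\mathrm{Ent}_*\mathcal Y\|_1$. The intrinsic entropy distance $\mathbf k(\mathcal X,\mathcal Y)$ is the infimum of $\mathrm{kd}(\mathcal K)$ over all such fans. Tropical conditioning: $[\mathcal X|U]$ is the tropical diagram $\int_{u\in U}\overrightarrow{(\mathcal X|u)}\,dp(u)$, i.e. the convex combination $\sum_{u\in U}p(u)\cdot\overrightarrow{(\mathcal X|u)}$, where $\overrightarrow{\mathcal A}$ is the tropical diagram represented by the sequence $(\mathcal A^n)_{n\in\mathbb N_0}$. Concretely, $[\mathcal X|U]$ is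 represented by the sequence of $\mathbf G$-diagrams $n\mapsto\bigotimes_{u\in U}(\mathcal X|u)^{\lfloor n\,p(u)\rfloor}$. The asymptotic entropy distance $\boldsymbol\kappa$ between tropical diagrams represented by such sequences $(\mathcal A(n))$ and $(\mathcal B(n))$ is $\lim_{n\to\infty}\frac1n\mathbf k(\mathcal A(n),\mathcal B(n))$. *)

theory Defs
  imports "HOL-Probability.Probability" "HOL-Probability.Product_PMF"
begin

section \<open>Indexing categories\<close>

record ('o, 'm) small_cat =
  Obj :: "'o set"
  Mor :: "'m set"
  src :: "'m \<Rightarrow> 'o"
  tgt :: "'m \<Rightarrow> 'o"
  ident :: "'o \<Rightarrow> 'm"
  compose :: "'m \<Rightarrow> 'm \<Rightarrow> 'm"  \<comment> \<open>\<open>compose C g f\<close> is "first \<open>f\<close>, then \<open>g\<close>"\<close>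

definition hom_set :: "('o, 'm) small_cat \<Rightarrow> 'o \<Rightarrow> 'o \<Rightarrow> 'm set" where
  "hom_set C i j = {f \<in> Mor C. src C f = i \<and> tgt C f = j}"

definition is_category :: "('o, 'm) small_cat \<Rightarrow> bool" where
  "is_category C \<longleftrightarrow>
     (\<forall>f\<in>Mor C. src C f \<in> Obj C \<and> tgt C f \<in> Obj C) \<and>
     (\<forall>i\<in>Obj C. ident C i \<in> hom_set C i i) \<and>
     (\<forall>f\<in>Mor C. \<forall>g\<in>Mor C. tgt C f = src C g \<longrightarrow>
        compose C g f \<in> hom_set C (src C f) (tgt C g)) \<and>
     (\<forall>f\<in>Mor C. compose C f (ident C (src C f)) = f \<and> compose C (ident C (tgt C f)) f = f) \<and>
     (\<forall>f\<in>Mor C. \<forall>g\<in>Mor C. \<forall>h\<in>Mor C. tgt C f = src C g \<longrightarrow> tgt C g = src C h \<longrightarrow>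
        compose C h (compose C g f) = compose C (compose C h g) f)"

definition ancestor :: "('o, 'm) small_cat \<Rightarrow> 'o \<Rightarrow> 'o \<Rightarrow> bool" where
  "ancestor C i j \<longleftrightarrow> hom_set C i j \<noteq> {}"

definition minimal_common_ancestor :: "('o, 'm) small_cat \<Rightarrow> 'o \<Rightarrow> 'o \<Rightarrow> 'o \<Rightarrow> bool" where
  "minimal_common_ancestor C h i j \<longleftrightarrow>
     h \<in> Obj C \<and> ancestor C h i \<and> ancestor C h j \<and>
     (\<forall>k\<in>Obj C. ancestor C k i \<and> ancestor C k j \<longrightarrow> ancestor C k h)"

text \<open>
  "At most one morphism between \<open>i\<close> and \<open>j\<close> either way" bounds both directions together, so
  distinct objects are never isomorphic and the only endomorphisms are identities.
\<close>

definition indexing_category :: "('o, 'm) small_cat \<Rightarrow> bool" where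
  "indexing_category C \<longleftrightarrow>
     is_category C \<and> finite (Obj C) \<and> finite (Mor C) \<and>
     (\<forall>i\<in>Obj C. \<forall>j\<in>Obj C. \<forall>f\<in>hom_set C i j \<union> hom_set C j i.
        \<forall>g\<in>hom_set C i j \<union> hom_set C j i. f = g) \<and>
     (\<forall>i\<in>Obj C. \<forall>j\<in>Obj C. \<exists>h. minimal_common_ancestor C h i j)"

definition initial_object :: "('o, 'm) small_cat \<Rightarrow> 'o" where
  "initial_object C = (THE z. z \<in> Obj C \<and> (\<forall>j\<in>Obj C. \<exists>!f. f \<in> hom_set C z j))"

definition the_mor :: "('o, 'm) small_cat \<Rightarrow> 'o \<Rightarrow> 'o \<Rightarrow> 'm" where
  "the_mor C i j = (THE f. f \<in> hom_set C i j)"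


section \<open>Diagrams of finite probability spaces\<close>

text \<open>
  A finite probability space is a \<open>pmf\<close> of finite support; its atoms are the elements of
  \<open>set_pmf\<close>. All spaces of one diagram live on a common type \<open>'s\<close> (underlying sets that differ
  from object to object are embedded in it). Since maps are identified when they agree almost
  everywhere, the functor laws and naturality are required almost everywhere.
\<close>

record ('o, 'm, 's) diagram =
  spc :: "'o \<Rightarrow> 's pmf"
  arr :: "'m \<Rightarrow> 's \<Rightarrow> 's"

definition is_reduction :: "('s \<Rightarrow> 't) \<Rightarrow> 's pmf \<Rightarrow> 't pmf \<Rightarrow> bool" where
  "is_reduction f p q \<longleftrightarrow> map_pmf f p = q"

definition is_diagram :: "('o, 'm) small_cat \<Rightarrow> ('o, 'm, 's) diagram \<Rightarrow> bool" where
  "is_diagram C X \<longleftrightarrow>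
     (\<forall>i\<in>Obj C. finite (set_pmf (spc X i))) \<and>
     (\<forall>f\<in>Mor C. is_reduction (arr X f) (spc X (src C f)) (spc X (tgt C f))) \<and>
     (\<forall>i\<in>Obj C. AE x in measure_pmf (spc X i). arr X (ident C i) x = x) \<and>
     (\<forall>f\<in>Mor C. \<forall>g\<in>Mor C. tgt C f = src C g \<longrightarrow>
        (AE x in measure_pmf (spc X (src C f)). arr X (compose C g f) x = arr X g (arr X f x)))"

definition is_diagram_reduction ::
  "('o, 'm) small_cat \<Rightarrow> ('o \<Rightarrow> 's \<Rightarrow> 't) \<Rightarrow> ('o, 'm, 's) diagram \<Rightarrow> ('o, 'm, 't) diagram \<Rightarrow> bool"
  where
  "is_diagram_reduction C \<phi> X Y \<longleftrightarrow>
     (\<forall>i\<in>Obj C. is_reduction (\<phi> i) (spc X i) (spc Y i)) \<and>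
     (\<forall>f\<in>Mor C. AE x in measure_pmf (spc X (src C f)).
        \<phi> (tgt C f) (arr X f x) = arr Y f (\<phi> (src C f) x))"

text \<open>
  Objectwise tensor product of a finite family. A point of a product space is a function on
  \<open>J\<close>, extended by \<open>undefined\<close>.
\<close>

definition tensor :: "'j set \<Rightarrow> ('j \<Rightarrow> ('o, 'm, 's) diagram) \<Rightarrow> ('o, 'm, 'j \<Rightarrow> 's) diagram" where
  "tensor J F =
     \<lparr>spc = (\<lambda>i. Pi_pmf J undefined (\<lambda>k. spc (F k) i)),
      arr = (\<lambda>f x. \<lambda>k\<in>J. arr (F k) f (x k))\<rparr>"

definition tensor_power :: "('o, 'm, 's) diagram \<Rightarrow> nat \<Rightarrow> ('o, 'm, nat \<Rightarrow> 's) diagram" where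
  "tensor_power X n = tensor {..<n} (\<lambda>_. X)"

text \<open>
  The diagram \<open>X|u\<close> for an atom \<open>u\<close> of \<open>spc X \<iota>\<close>. For the initial object the push-forward below is
  along an identity.
\<close>

definition cond_diagram ::
  "('o, 'm) small_cat \<Rightarrow> ('o, 'm, 's) diagram \<Rightarrow> 'o \<Rightarrow> 's \<Rightarrow> ('o, 'm, 's) diagram" where
  "cond_diagram C X \<iota> u =
     (let z = initial_object C;
          \<sigma> = arr X (the_mor C z \<iota>);
          p0 = cond_pmf (spc X z) (\<sigma> -` {u})
      in \<lparr>spc = (\<lambda>i. map_pmf (arr X (the_mor C z i)) p0), arr = arr X\<rparr>)"


section \<open>Entropy distances\<close>

definition shannon_entropy :: "'s pmf \<Rightarrow> real" where
  "shannon_entropy p = - (\<Sum>x\<in>set_pmf p. pmf p x * ln (pmf p x))"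

definition is_fan ::
  "('o, 'm) small_cat \<Rightarrow> ('o, 'm, 's) diagram \<Rightarrow> ('o, 'm, 'r) diagram \<Rightarrow> ('o, 'm, 't) diagram \<Rightarrow>
   ('o \<Rightarrow> 'r \<Rightarrow> 's) \<Rightarrow> ('o \<Rightarrow> 'r \<Rightarrow> 't) \<Rightarrow> bool" where
  "is_fan C X Z Y \<phi> \<psi> \<longleftrightarrow>
     is_diagram C Z \<and> is_diagram_reduction C \<phi> Z X \<and> is_diagram_reduction C \<psi> Z Y"

definition kd ::
  "('o, 'm) small_cat \<Rightarrow> ('o, 'm, 's) diagram \<Rightarrow> ('o, 'm, 'r) diagram \<Rightarrow> ('o, 'm, 't) diagram \<Rightarrow>
   real" where
  "kd C X Z Y =
     (\<Sum>i\<in>Obj C. \<bar>shannon_entropy (spc Z i) - shannon_entropy (spc X i)\<bar>) +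
     (\<Sum>i\<in>Obj C. \<bar>shannon_entropy (spc Z i) - shannon_entropy (spc Y i)\<bar>)"

text \<open>
  HOL cannot quantify over the type of the apex \<open>Z\<close>. Every finite probability space is isomorphic
  to one on \<open>nat\<close>, so the infimum is taken over apexes on \<open>nat\<close>; \<open>entropy_dist_le_kd\<close> shows that
  fans with apex on any other type give nothing smaller, and \<open>ex_nat_fan\<close> that the infimum is
  never over the empty set.
\<close>

definition entropy_dist ::
  "('o, 'm) small_cat \<Rightarrow> ('o, 'm, 's) diagram \<Rightarrow> ('o, 'm, 't) diagram \<Rightarrow> real" where
  "entropy_dist C X Y = Inf {kd C X Z Y | (Z :: ('o, 'm, nat) diagram) \<phi> \<psi>. is_fan C X Z Y \<phi> \<psi>}"

lemma shannon_entropy_map_inj: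
  assumes "inj_on f (set_pmf p)"
  shows "shannon_entropy (map_pmf f p) = shannon_entropy p"
  using assms
  by (simp add: shannon_entropy_def sum.reindex pmf_map_inj)

lemma fan_to_nat:
  fixes Z :: "('o, 'm, 'r) diagram"
  assumes C: "is_category C" and fan: "is_fan C X Z Y \<phi> \<psi>"
  shows "\<exists>(Z' :: ('o, 'm, nat) diagram) \<phi>' \<psi>'. is_fan C X Z' Y \<phi>' \<psi>' \<and> kd C X Z' Y = kd C X Z Y"
proof -
  define e where "e i = to_nat_on (set_pmf (spc Z i))" for i
  define d where "d i = from_nat_into (set_pmf (spc Z i))" for i
  have de: "d i (e i x) = x" if "x \<in> set_pmf (spc Z i)" for i x
    using that by (simp add: d_def e_def)
  have inj: "inj_on (e i) (set_pmf (spc Z i))" for i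
    unfolding e_def by (rule inj_on_to_nat_on) simp
  have map_de: "map_pmf (\<lambda>x. h (d i (e i x))) (spc Z i) = map_pmf h (spc Z i)"
    for i and h :: "'r \<Rightarrow> 'z"
    by (rule map_pmf_cong) (auto simp: de)
  define Z' :: "('o, 'm, nat) diagram" where
    "Z' = \<lparr>spc = (\<lambda>i. map_pmf (e i) (spc Z i)),
          arr = (\<lambda>f. e (tgt C f) \<circ> arr Z f \<circ> d (src C f))\<rparr>"
  have st: "src C (ident C i) = i \<and> tgt C (ident C i) = i" if "i \<in> Obj C" for i
    using C that by (auto simp: is_category_def hom_set_def)
  have co: "src C (compose C g f) = src C f \<and> tgt C (compose C g f) = tgt C g"
    if "f \<in> Mor C" "g \<in> Mor C" "tgt C f = src C g" for f g
    using C that by (auto simp: is_category_def hom_set_def)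
  have mem: "arr Z f x \<in> set_pmf (spc Z (tgt C f))"
    if "f \<in> Mor C" "x \<in> set_pmf (spc Z (src C f))" for f x
  proof -
    have "map_pmf (arr Z f) (spc Z (src C f)) = spc Z (tgt C f)"
      using fan that by (auto simp: is_fan_def is_diagram_def is_reduction_def)
    with that show ?thesis by (metis pmf.set_map imageI)
  qed
  have r1: "map_pmf (arr Z' f) (spc Z' (src C f)) = spc Z' (tgt C f)" if "f \<in> Mor C" for f
  proof -
    have "map_pmf (arr Z' f) (spc Z' (src C f)) =
        map_pmf (\<lambda>x. (e (tgt C f) \<circ> arr Z f) (d (src C f) (e (src C f) x))) (spc Z (src C f))"
      by (simp add: Z'_def pmf.map_comp o_def)
    also have "\<dots> = map_pmf (e (tgt C f)) (map_pmf (arr Z f) (spc Z (src C f)))"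
      by (subst map_de) (simp add: pmf.map_comp)
    also have "map_pmf (arr Z f) (spc Z (src C f)) = spc Z (tgt C f)"
      using fan that by (auto simp: is_fan_def is_diagram_def is_reduction_def)
    finally show ?thesis by (simp add: Z'_def o_def)
  qed
  have dia: "is_diagram C Z'"
    unfolding is_diagram_def is_reduction_def
  proof (intro conjI ballI impI)
    fix i assume "i \<in> Obj C"
    then show "finite (set_pmf (spc Z' i))"
      using fan by (auto simp: Z'_def is_fan_def is_diagram_def)
  next
    fix f assume "f \<in> Mor C"
    then show "map_pmf (arr Z' f) (spc Z' (src C f)) = spc Z' (tgt C f)" by (rule r1)
  next
    fix i assume i: "i \<in> Obj C"
    then show "AE x in measure_pmf (spc Z' i). arr Z' (ident C i) x = x"
      using fan by (auto simp: Z'_def st AE_measure_pmf_iff de is_fan_def is_diagram_def)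
  next
    fix f g assume fg: "f \<in> Mor C" "g \<in> Mor C" "tgt C f = src C g"
    then have "AE x in measure_pmf (spc Z (src C f)).
        arr Z (compose C g f) x = arr Z g (arr Z f x)"
      using fan by (auto simp: is_fan_def is_diagram_def)
    then show "AE x in measure_pmf (spc Z' (src C f)).
        arr Z' (compose C g f) x = arr Z' g (arr Z' f x)"
      using fg mem[OF fg(1)] by (auto simp: Z'_def co AE_measure_pmf_iff de)
  qed
  have red: "is_diagram_reduction C (\<lambda>i. \<theta> i \<circ> d i) Z' W" if "is_diagram_reduction C \<theta> Z W"
    for \<theta> :: "'o \<Rightarrow> 'r \<Rightarrow> 'w" and W
    unfolding is_diagram_reduction_def is_reduction_def
  proof (intro conjI ballI)
    fix i assume "i \<in> Obj C"
    then have "map_pmf (\<theta> i) (spc Z i) = spc W i"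
      using that by (auto simp: is_diagram_reduction_def is_reduction_def)
    then show "map_pmf (\<theta> i \<circ> d i) (spc Z' i) = spc W i"
      by (simp add: Z'_def pmf.map_comp o_def map_de)
  next
    fix f assume f: "f \<in> Mor C"
    then show "AE x in measure_pmf (spc Z' (src C f)).
        (\<theta> (tgt C f) \<circ> d (tgt C f)) (arr Z' f x) = arr W f ((\<theta> (src C f) \<circ> d (src C f)) x)"
      using that mem[OF f]
      by (auto simp: Z'_def AE_measure_pmf_iff de is_diagram_reduction_def)
  qed
  have "kd C X Z' Y = kd C X Z Y"
    by (simp add: kd_def Z'_def shannon_entropy_map_inj[OF inj])
  moreover have "is_fan C X Z' Y (\<lambda>i. \<phi> i \<circ> d i) (\<lambda>i. \<psi> i \<circ> d i)"
    using fan dia by (auto simp: is_fan_def intro: red)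
  ultimately show ?thesis by blast
qed

lemma ex_nat_fan:
  assumes "is_category C" "is_diagram C X" "is_diagram C Y"
  shows "\<exists>(Z :: ('o, 'm, nat) diagram) \<phi> \<psi>. is_fan C X Z Y \<phi> \<psi>"
proof -
  define Z where "Z = \<lparr>spc = (\<lambda>i. pair_pmf (spc X i) (spc Y i)),
                       arr = (\<lambda>f. map_prod (arr X f) (arr Y f))\<rparr>"
  have "is_diagram C Z"
    using assms
    by (auto simp: is_diagram_def is_reduction_def Z_def AE_measure_pmf_iff
        map_prod_def map_pair)
  then have "is_fan C X Z Y (\<lambda>_. fst) (\<lambda>_. snd)"
    by (auto simp: is_fan_def is_diagram_reduction_def is_reduction_def Z_def
        map_fst_pair_pmf map_snd_pair_pmf AE_measure_pmf_iff)
  from fan_to_nat[OF assms(1) this] show ?thesis by blast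
qed

lemma entropy_dist_le_kd:
  fixes Z :: "('o, 'm, 'r) diagram"
  assumes "is_category C" "is_fan C X Z Y \<phi> \<psi>"
  shows "entropy_dist C X Y \<le> kd C X Z Y"
proof -
  let ?S = "{kd C X Z Y | (Z :: ('o, 'm, nat) diagram) \<phi> \<psi>. is_fan C X Z Y \<phi> \<psi>}"
  have "bdd_below ?S"
    by (rule bdd_belowI[of _ 0]) (auto simp: kd_def intro!: add_nonneg_nonneg sum_nonneg)
  moreover have "kd C X Z Y \<in> ?S"
    using fan_to_nat[OF assms] by force
  ultimately show ?thesis
    unfolding entropy_dist_def by (rule cInf_lower[rotated])
qed


section \<open>Tropical conditioning\<close>

text \<open>The sequence of diagrams representing the tropical diagram \<open>[X|U]\<close> with \<open>U = spc X \<iota>\<close>.\<close>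

definition tropical_cond ::
  "('o, 'm) small_cat \<Rightarrow> ('o, 'm, 's) diagram \<Rightarrow> 'o \<Rightarrow> nat \<Rightarrow> ('o, 'm, 's \<Rightarrow> nat \<Rightarrow> 's) diagram" where
  "tropical_cond C X \<iota> n =
     tensor (set_pmf (spc X \<iota>))
       (\<lambda>u. tensor_power (cond_diagram C X \<iota> u) (nat \<lfloor>real n * pmf (spc X \<iota>) u\<rfloor>))"

text \<open>
  \<open>lim\<close> is unspecified for a divergent sequence, so a bound on this value is only provable together
  with the existence of the limit.
\<close>

definition asymptotic_entropy_dist ::
  "('o, 'm) small_cat \<Rightarrow> (nat \<Rightarrow> ('o, 'm, 's) diagram) \<Rightarrow> (nat \<Rightarrow> ('o, 'm, 't) diagram) \<Rightarrow> real" where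
  "asymptotic_entropy_dist C A B = lim (\<lambda>n. 1 / real n * entropy_dist C (A n) (B n))"

end

theory Submission
  imports Defs
begin

text \<open>
  A fan over \<open>X\<close> and \<open>Y\<close> can be replaced by a coupling of the two initial spaces, so the entropy
  distance is an infimum over couplings. Fix a coupling \<open>r\<close> and let \<open>c = (u, v)\<close> be its image in
  \<open>X_\<iota> \<times> Y_\<iota>\<close>. The space \<open>X|u\<close> is the mixture of the spaces \<open>X|c\<close> over all \<open>c\<close> extending \<open>u\<close>, and
  likewise \<open>Y|v\<close>. Draw a class \<open>c\<close> independently at each of the roughly \<open>n\<close> factors of the tensor
  powers representing \<open>[X|U]\<close> and \<open>[Y|V]\<close>. Knowing these classes changes each of the joint entropies
  by at most \<open>n (H(V|U) + H(U|V))\<close>, which is at most \<open>n kd\<close> since this is the term of \<open>kd\<close> at \<open>\<iota>\<close>; this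
  gives the contribution \<open>2 |G| kd\<close>. Given the classes, every class occurs on both sides about
  \<open>n r(c)\<close> times, up to \<open>O(sqrt n)\<close> by the variance of a binomial count, and factors of equal class are
  matched by \<open>r\<close> conditioned on \<open>c\<close>. By submodularity of entropy this costs at most \<open>n kd\<close> on average.
  The limit exists because the sequence is subadditive up to a constant, the floors being additive up
  to one.
\<close>

section \<open>Expectation and entropy of finite distributions\<close>

text \<open>A fan must have exactly the prescribed marginals, and a product of spaces
  \<open>X|c\<close> with fixed classes differs from a power of \<open>X|u\<close>, the mixture of
  these spaces. Hence the classes have to be random and independent from factor to factor, and the
  counts on the two sides agree only up to fluctuations. The draws for \<open>X\<close> and for
  \<open>Y\<close> are independent of each other; the two counts of a class still meet because both
  concentrate near the same multiple of its weight. The factor 2 in 2 |G| is the weight of the joint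
  entropy in the cost of a fan. Only this entropy suffers from revealing the classes: the two
  marginal entropies enter with a minus sign, and concavity bounds them from below by their
  conditional averages. The infimum over couplings need not be attained, so all estimates concern an
  existing coupling with an explicit bound on its cost. One coupling has to serve all objects at
  once, since only the sum over the objects is controlled.\<close>

abbreviation "expect \<equiv> measure_pmf.expectation"

lemma expect_finite:
  fixes g :: "'a \<Rightarrow> real"
  assumes "finite (set_pmf p)"
  shows "expect p g = (\<Sum>x\<in>set_pmf p. pmf p x * g x)"
  using assms by (subst integral_measure_pmf[of "set_pmf p"]) auto

lemma expect_cong:
  assumes "\<And>x. x \<in> set_pmf p \<Longrightarrow> g x = h x"
  shows "expect p g = expect p h"
  by (rule integral_cong_AE) (auto simp: AE_measure_pmf_iff assms)

lemma expect_mono: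
  fixes g h :: "'a \<Rightarrow> real"
  assumes "finite (set_pmf p)" "\<And>x. x \<in> set_pmf p \<Longrightarrow> g x \<le> h x"
  shows "expect p g \<le> expect p h"
  unfolding expect_finite[OF assms(1)] by (intro sum_mono mult_left_mono assms(2)) auto

lemma expect_bind:
  fixes g :: "'b \<Rightarrow> real"
  assumes "finite (set_pmf M)" "\<And>w. w \<in> set_pmf M \<Longrightarrow> finite (set_pmf (P w))"
  shows "expect (bind_pmf M P) g = expect M (\<lambda>w. expect (P w) g)"
  using assms by (subst pmf_expectation_bind[of "set_pmf M"]) (auto simp: expect_finite)

lemma expect_add:
  fixes g h :: "'a \<Rightarrow> real"
  assumes "finite (set_pmf p)"
  shows "expect p (\<lambda>x. g x + h x) = expect p g + expect p h"
  using assms by (simp add: expect_finite distrib_left sum.distrib)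

lemma expect_diff:
  fixes g h :: "'a \<Rightarrow> real"
  assumes "finite (set_pmf p)"
  shows "expect p (\<lambda>x. g x - h x) = expect p g - expect p h"
  using assms by (simp add: expect_finite right_diff_distrib sum_subtractf)

lemma expect_sum:
  fixes g :: "'i \<Rightarrow> 'a \<Rightarrow> real"
  assumes "finite (set_pmf p)"
  shows "expect p (\<lambda>x. \<Sum>i\<in>I. g i x) = (\<Sum>i\<in>I. expect p (g i))"
  using assms by (simp add: expect_finite sum_distrib_left) (rule sum.swap)

lemma expect_nonneg:
  fixes g :: "'a \<Rightarrow> real"
  assumes "finite (set_pmf p)" "\<And>x. x \<in> set_pmf p \<Longrightarrow> 0 \<le> g x"
  shows "0 \<le> expect p g"
  using expect_mono[OF assms(1), of "\<lambda>_. 0" g] assms(2) by simp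

lemma pmf_map_ge: "pmf p x \<le> pmf (map_pmf f p) (f x)"
proof -
  have "pmf p x = measure p {x}" by (simp add: measure_pmf_single)
  also have "\<dots> \<le> measure p (f -` {f x})"
    by (rule measure_pmf.finite_measure_mono) auto
  finally show ?thesis by (simp add: pmf_map)
qed

section \<open>Entropy of images, mixtures and products\<close>

lemma entropy_expect:
  assumes "finite (set_pmf p)"
  shows "shannon_entropy p = expect p (\<lambda>x. - ln (pmf p x))"
  using assms by (simp add: shannon_entropy_def expect_finite sum_negf)

lemma entropy_map:
  assumes "finite (set_pmf p)"
  shows "shannon_entropy (map_pmf f p) = expect p (\<lambda>x. - ln (pmf (map_pmf f p) (f x)))"
  using assms by (simp add: entropy_expect)

lemma entropy_nonneg: "0 \<le> shannon_entropy p"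
  unfolding shannon_entropy_def neg_0_le_iff_le
  by (intro sum_nonpos mult_nonneg_nonpos) (auto simp: pmf_positive pmf_le_1)

lemma entropy_return [simp]: "shannon_entropy (return_pmf x) = 0"
  by (simp add: shannon_entropy_def)

lemma entropy_map_le:
  assumes "finite (set_pmf p)"
  shows "shannon_entropy (map_pmf f p) \<le> shannon_entropy p"
  unfolding entropy_map[OF assms] entropy_expect[OF assms]
  by (intro expect_mono assms) (auto intro!: pmf_map_ge simp: pmf_positive order_less_le_trans[OF _ pmf_map_ge])

text \<open>Agreement on atoms suffices, so the almost everywhere identities of diagrams and
  reductions can be fed in directly.\<close>

lemma entropy_map_factor:
  assumes "finite (set_pmf p)" "\<And>x. x \<in> set_pmf p \<Longrightarrow> f x = e (g x)"
  shows "shannon_entropy (map_pmf f p) \<le> shannon_entropy (map_pmf g p)"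
proof -
  have "map_pmf f p = map_pmf e (map_pmf g p)"
    by (auto simp: pmf.map_comp assms(2) intro!: map_pmf_cong)
  then show ?thesis using entropy_map_le[of "map_pmf g p" e] assms(1) by simp
qed

text \<open>Gibbs' inequality \<open>ln t \<le> t - 1\<close>, applied to \<open>t = P(a,b) P(b,c) / (P(a,b,c) P(b))\<close>.\<close>

lemma entropy_submodular:
  assumes fin: "finite (set_pmf p)"
  shows "shannon_entropy (map_pmf (\<lambda>x. (A x, B x, C x)) p) + shannon_entropy (map_pmf B p)
    \<le> shannon_entropy (map_pmf (\<lambda>x. (A x, B x)) p) + shannon_entropy (map_pmf (\<lambda>x. (B x, C x)) p)"
proof -
  define P3 where "P3 = map_pmf (\<lambda>x. (A x, B x, C x)) p"
  define P1 where "P1 = map_pmf B p"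
  define PA where "PA = map_pmf (\<lambda>x. (A x, B x)) p"
  define PC where "PC = map_pmf (\<lambda>x. (B x, C x)) p"
  define t where "t = (\<lambda>(a,b,c). pmf PA (a,b) * pmf PC (b,c) / (pmf P3 (a,b,c) * pmf P1 b))"
  have pos: "pmf P3 (A x, B x, C x) > 0" "pmf P1 (B x) > 0" "pmf PA (A x, B x) > 0" "pmf PC (B x, C x) > 0"
    if "x \<in> set_pmf p" for x
    using that by (auto simp: P3_def P1_def PA_def PC_def intro!: pmf_positive)
  have finS: "finite (A ` set_pmf p)" "finite (B ` set_pmf p)" "finite (C ` set_pmf p)"
    using fin by auto
  have mA: "(\<Sum>a\<in>A ` set_pmf p. pmf PA (a,b)) = pmf P1 b" for b
  proof -
    have "P1 = map_pmf snd PA" by (simp add: P1_def PA_def pmf.map_comp o_def)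
    then have "pmf P1 b = measure PA (snd -` {b})" by (simp add: pmf_map)
    also have "\<dots> = measure PA ((\<lambda>a. (a,b)) ` A ` set_pmf p)"
      by (rule measure_prob_cong_0) (force simp: PA_def set_pmf_iff[symmetric] pmf_eq_0_set_pmf)+
    also have "\<dots> = (\<Sum>z\<in>(\<lambda>a. (a,b)) ` A ` set_pmf p. pmf PA z)"
      by (rule measure_measure_pmf_finite) (use finS in auto)
    also have "\<dots> = (\<Sum>a\<in>A ` set_pmf p. pmf PA (a,b))"
      by (subst sum.reindex) (auto simp: inj_on_def)
    finally show ?thesis by simp
  qed
  have mC: "(\<Sum>c\<in>C ` set_pmf p. pmf PC (b,c)) = pmf P1 b" for b
  proof -
    have "P1 = map_pmf fst PC" by (simp add: P1_def PC_def pmf.map_comp o_def)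
    then have "pmf P1 b = measure PC (fst -` {b})" by (simp add: pmf_map)
    also have "\<dots> = measure PC ((\<lambda>a. (b,a)) ` C ` set_pmf p)"
      by (rule measure_prob_cong_0) (force simp: PC_def set_pmf_iff[symmetric] pmf_eq_0_set_pmf)+
    also have "\<dots> = (\<Sum>z\<in>(\<lambda>a. (b,a)) ` C ` set_pmf p. pmf PC z)"
      by (rule measure_measure_pmf_finite) (use finS in auto)
    also have "\<dots> = (\<Sum>c\<in>C ` set_pmf p. pmf PC (b,c))"
      by (subst sum.reindex) (auto simp: inj_on_def)
    finally show ?thesis by simp
  qed
  have "expect p (\<lambda>x. t (A x, B x, C x)) = expect P3 t"
    by (simp add: P3_def)
  also have "\<dots> = (\<Sum>z\<in>set_pmf P3. pmf P3 z * t z)"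
    by (rule expect_finite) (simp add: P3_def fin)
  \<comment> \<open>Triples of positive weight may form a proper part of the product of the three
    ranges, so \<open>t\<close> has expectation at most 1 and not always equal to 1.\<close>
  also have "\<dots> \<le> (\<Sum>(a,b,c)\<in>A ` set_pmf p \<times> B ` set_pmf p \<times> C ` set_pmf p.
      pmf PA (a,b) * pmf PC (b,c) / pmf P1 b)"
  proof -
    have "(\<Sum>z\<in>set_pmf P3. pmf P3 z * t z) =
        (\<Sum>(a,b,c)\<in>set_pmf P3. pmf PA (a,b) * pmf PC (b,c) / pmf P1 b)"
      by (rule sum.cong) (auto simp: t_def set_pmf_iff)
    also have "\<dots> \<le> (\<Sum>(a,b,c)\<in>A ` set_pmf p \<times> B ` set_pmf p \<times> C ` set_pmf p.
      pmf PA (a,b) * pmf PC (b,c) / pmf P1 b)"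
      by (rule sum_mono2) (use finS in \<open>auto simp: P3_def\<close>)
    finally show ?thesis .
  qed
  also have "\<dots> = (\<Sum>b\<in>B ` set_pmf p. (\<Sum>a\<in>A ` set_pmf p. pmf PA (a,b)) * (\<Sum>c\<in>C ` set_pmf p. pmf PC (b,c)) / pmf P1 b)"
    by (simp add: sum.cartesian_product[symmetric] sum_product sum_divide_distrib) (rule sum.swap)
  also have "\<dots> = (\<Sum>b\<in>set_pmf P1. pmf P1 b)"
    unfolding mA mC by (rule sum.cong) (auto simp: P1_def)
  also have "\<dots> = 1" by (rule sum_pmf_eq_1) (simp_all add: P1_def fin)
  finally have t1: "expect p (\<lambda>x. t (A x, B x, C x)) \<le> 1" .
  have "shannon_entropy P3 + shannon_entropy P1 - shannon_entropy PA - shannon_entropy PC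
    = expect p (\<lambda>x. - ln (pmf P3 (A x, B x, C x))) + expect p (\<lambda>x. - ln (pmf P1 (B x)))
      - expect p (\<lambda>x. - ln (pmf PA (A x, B x))) - expect p (\<lambda>x. - ln (pmf PC (B x, C x)))"
    unfolding P3_def P1_def PA_def PC_def by (simp only: entropy_map[OF fin])
  also have "\<dots> = expect p (\<lambda>x. - ln (pmf P3 (A x, B x, C x)) + - ln (pmf P1 (B x))
       - - ln (pmf PA (A x, B x)) - - ln (pmf PC (B x, C x)))"
    by (simp only: expect_add[OF fin] expect_diff[OF fin])
  also have "\<dots> \<le> expect p (\<lambda>x. t (A x, B x, C x) - 1)"
  proof (rule expect_mono[OF fin])
    fix x assume x: "x \<in> set_pmf p"
    have "ln (t (A x, B x, C x)) \<le> t (A x, B x, C x) - 1"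
      by (rule ln_le_minus_one) (use pos[OF x] in \<open>simp add: t_def\<close>)
    then show "- ln (pmf P3 (A x, B x, C x)) + - ln (pmf P1 (B x)) - - ln (pmf PA (A x, B x)) -
         - ln (pmf PC (B x, C x)) \<le> t (A x, B x, C x) - 1"
      using pos[OF x] by (simp add: t_def ln_div ln_mult)
  qed
  also have "\<dots> \<le> 0" using t1 by (simp add: expect_diff[OF fin])
  finally show ?thesis unfolding P3_def P1_def PA_def PC_def by simp
qed

text \<open>A labelled sample has weight \<open>pmf M w * pmf (P w) x\<close>, so its logarithm
  splits into the two summands.\<close>

lemma entropy_chain:
  assumes M: "finite (set_pmf M)" and P: "\<And>w. w \<in> set_pmf M \<Longrightarrow> finite (set_pmf (P w))"
  shows "shannon_entropy (bind_pmf M (\<lambda>w. map_pmf (Pair w) (P w))) =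
    shannon_entropy M + expect M (\<lambda>w. shannon_entropy (P w))"
proof -
  let ?J = "bind_pmf M (\<lambda>w. map_pmf (Pair w) (P w))"
  have pJ: "pmf ?J (w, x) = pmf M w * pmf (P w) x" for w x
  proof -
    have "pmf ?J (w, x) = expect M (\<lambda>w'. pmf (map_pmf (Pair w') (P w')) (w, x))"
      by (simp add: pmf_bind)
    also have "\<dots> = expect M (\<lambda>w'. indicator {w} w' * pmf (P w) x)"
    proof (rule expect_cong)
      fix w'
      have "pmf (map_pmf (Pair w) (P w)) (w, x) = pmf (P w) x"
        by (rule pmf_map_inj') (auto simp: inj_on_def)
      moreover have "pmf (map_pmf (Pair w') (P w')) (w, x) = 0" if "w' \<noteq> w"
        using that by (auto simp: pmf_eq_0_set_pmf)
      ultimately show "pmf (map_pmf (Pair w') (P w')) (w, x) = indicator {w} w' * pmf (P w) x"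
        by (cases "w' = w") auto
    qed
    also have "\<dots> = pmf M w * pmf (P w) x" by (simp add: measure_pmf_single)
    finally show ?thesis .
  qed
  have finJ: "finite (set_pmf ?J)" using M P by auto
  have "shannon_entropy ?J = expect M (\<lambda>w. expect (P w) (\<lambda>x. - ln (pmf ?J (w, x))))"
    unfolding entropy_expect[OF finJ] by (subst expect_bind) (use M P in auto)
  also have "\<dots> = expect M (\<lambda>w. - ln (pmf M w) + shannon_entropy (P w))"
  proof (rule expect_cong)
    fix w assume w: "w \<in> set_pmf M"
    have "expect (P w) (\<lambda>x. - ln (pmf ?J (w, x))) = expect (P w) (\<lambda>x. - ln (pmf M w) + - ln (pmf (P w) x))"
      by (rule expect_cong) (use w in \<open>simp add: pJ ln_mult pmf_eq_0_set_pmf\<close>)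
    then show "expect (P w) (\<lambda>x. - ln (pmf ?J (w, x))) = - ln (pmf M w) + shannon_entropy (P w)"
      using P[OF w] by (simp add: expect_diff entropy_expect)
  qed
  finally show ?thesis using M by (simp add: expect_add expect_diff entropy_expect)
qed

text \<open>The mixture is the image of the labelled sample under forgetting the label.\<close>

lemma entropy_bind_le:
  assumes "finite (set_pmf M)" "\<And>w. w \<in> set_pmf M \<Longrightarrow> finite (set_pmf (P w))"
  shows "shannon_entropy (bind_pmf M P) \<le> shannon_entropy M + expect M (\<lambda>w. shannon_entropy (P w))"
proof -
  have "bind_pmf M P = map_pmf snd (bind_pmf M (\<lambda>w. map_pmf (Pair w) (P w)))"
    by (simp add: map_bind_pmf pmf.map_comp o_def)
  then show ?thesis
    using entropy_map_le[of "bind_pmf M (\<lambda>w. map_pmf (Pair w) (P w))" snd] assms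
    by (simp add: entropy_chain)
qed

text \<open>Concavity of entropy. With a constant in the middle, submodularity says that label and
  sample together have at most the sum of their entropies; the chain rule then cancels the entropy
  of the label.\<close>

lemma entropy_bind_ge:
  assumes "finite (set_pmf M)" "\<And>w. w \<in> set_pmf M \<Longrightarrow> finite (set_pmf (P w))"
  shows "expect M (\<lambda>w. shannon_entropy (P w)) \<le> shannon_entropy (bind_pmf M P)"
proof -
  let ?J = "bind_pmf M (\<lambda>w. map_pmf (Pair w) (P w))"
  have finJ: "finite (set_pmf ?J)" using assms by auto
  have 1: "shannon_entropy (map_pmf (\<lambda>x. (fst x, (), snd x)) ?J) = shannon_entropy ?J"
    by (rule shannon_entropy_map_inj) (auto simp: inj_on_def)
  have 2: "shannon_entropy (map_pmf (\<lambda>x. ()) ?J) = 0" by simp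
  have 3: "map_pmf (\<lambda>x. (fst x, ())) ?J = map_pmf (\<lambda>x. (x, ())) M"
    by (simp add: map_bind_pmf pmf.map_comp o_def bind_return_pmf' flip: map_pmf_def)
  have 4: "map_pmf (\<lambda>x. ((), snd x)) ?J = map_pmf (\<lambda>x. ((), x)) (bind_pmf M P)"
    by (simp add: map_bind_pmf pmf.map_comp o_def)
  have 5: "shannon_entropy (map_pmf (\<lambda>x. (x, ())) M) = shannon_entropy M"
    by (rule shannon_entropy_map_inj) (auto simp: inj_on_def)
  have 6: "shannon_entropy (map_pmf (\<lambda>x. ((), x)) (bind_pmf M P)) = shannon_entropy (bind_pmf M P)"
    by (rule shannon_entropy_map_inj) (auto simp: inj_on_def)
  show ?thesis
    using entropy_submodular[OF finJ, of fst "\<lambda>_. ()" snd] unfolding 1 2 3 4 5 6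
    using entropy_chain[OF assms] by simp
qed

lemma entropy_pair:
  assumes "finite (set_pmf p)" "finite (set_pmf q)"
  shows "shannon_entropy (pair_pmf p q) = shannon_entropy p + shannon_entropy q"
proof -
  have "pair_pmf p q = bind_pmf p (\<lambda>w. map_pmf (Pair w) q)"
    by (simp add: pair_pmf_def map_pmf_def)
  then show ?thesis using entropy_chain[of p "\<lambda>_. q"] assms by simp
qed

section \<open>Couplings of observed distributions\<close>

text \<open>The contribution of one object to \<open>kd\<close> for the fan whose apex is the joint
  image of the coupling under the two observations.\<close>

definition obs_cost :: "('a \<Rightarrow> 'c) \<Rightarrow> ('b \<Rightarrow> 'd) \<Rightarrow> ('a \<times> 'b) pmf \<Rightarrow> real" where
  "obs_cost f g r = 2 * shannon_entropy (map_pmf (map_prod f g) r)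
     - shannon_entropy (map_pmf f (map_pmf fst r)) - shannon_entropy (map_pmf g (map_pmf snd r))"

text \<open>The same \<open>r\<close> is used for every index, and \<open>c\<close> is an upper
  bound in place of an infimum, so that couplings can be combined without any minimizer.\<close>

definition coupled ::
  "'o set \<Rightarrow> 'a pmf \<Rightarrow> ('o \<Rightarrow> 'a \<Rightarrow> 'c) \<Rightarrow> 'b pmf \<Rightarrow> ('o \<Rightarrow> 'b \<Rightarrow> 'd) \<Rightarrow> real \<Rightarrow> bool" where
  "coupled I p f q g c \<longleftrightarrow>
     (\<exists>r. map_pmf fst r = p \<and> map_pmf snd r = q \<and> (\<Sum>i\<in>I. obs_cost (f i) (g i) r) \<le> c)"

lemma finite_coupling:
  assumes "finite (set_pmf (map_pmf fst r))" "finite (set_pmf (map_pmf snd r))"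
  shows "finite (set_pmf r)"
proof (rule finite_subset)
  show "set_pmf r \<subseteq> set_pmf (map_pmf fst r) \<times> set_pmf (map_pmf snd r)" by force
  show "finite (set_pmf (map_pmf fst r) \<times> set_pmf (map_pmf snd r))"
    using assms by (rule finite_cartesian_product)
qed

lemma obs_cost_nonneg:
  assumes "finite (set_pmf r)"
  shows "0 \<le> obs_cost f g r"
proof -
  have "shannon_entropy (map_pmf f (map_pmf fst r)) \<le> shannon_entropy (map_pmf (map_prod f g) r)"
    unfolding pmf.map_comp by (rule entropy_map_factor[where e = fst]) (auto simp: assms)
  moreover have "shannon_entropy (map_pmf g (map_pmf snd r)) \<le> shannon_entropy (map_pmf (map_prod f g) r)"
    unfolding pmf.map_comp by (rule entropy_map_factor[where e = snd]) (auto simp: assms)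
  ultimately show ?thesis by (simp add: obs_cost_def)
qed

lemma coupledI:
  assumes "map_pmf fst r = p" "map_pmf snd r = q" "(\<Sum>i\<in>I. obs_cost (f i) (g i) r) \<le> c"
  shows "coupled I p f q g c"
  using assms unfolding coupled_def by blast

lemma coupled_mono: "coupled I p f q g c \<Longrightarrow> c \<le> c' \<Longrightarrow> coupled I p f q g c'"
  unfolding coupled_def by force

lemma coupled_sym:
  assumes "coupled I p f q g c"
  shows "coupled I q g p f c"
proof -
  obtain r where r: "map_pmf fst r = p" "map_pmf snd r = q" "(\<Sum>i\<in>I. obs_cost (f i) (g i) r) \<le> c"
    using assms unfolding coupled_def by blast
  let ?r = "map_pmf prod.swap r"
  have "obs_cost (g i) (f i) ?r = obs_cost (f i) (g i) r" for i
  proof -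
    have "map_pmf (map_prod (g i) (f i)) ?r = map_pmf prod.swap (map_pmf (map_prod (f i) (g i)) r)"
      by (auto simp: pmf.map_comp intro!: map_pmf_cong)
    moreover have "shannon_entropy (map_pmf prod.swap (map_pmf (map_prod (f i) (g i)) r))
        = shannon_entropy (map_pmf (map_prod (f i) (g i)) r)"
      by (rule shannon_entropy_map_inj) (auto simp: inj_on_def)
    ultimately show ?thesis unfolding obs_cost_def by (simp add: pmf.map_comp o_def)
  qed
  with r show ?thesis by (intro coupledI[of ?r]) (auto simp: pmf.map_comp o_def)
qed

lemma coupled_sym_iff: "coupled I p f q g c \<longleftrightarrow> coupled I q g p f c"
  by (rule iffI; erule coupled_sym)

text \<open>The fallback when nothing is known about the two sides: under independence the joint
  entropy is the sum, so the cost is the full entropy of both.\<close>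

lemma coupled_indep:
  assumes "finite (set_pmf p)" "finite (set_pmf q)"
  shows "coupled I p f q g
    (\<Sum>i\<in>I. shannon_entropy (map_pmf (f i) p) + shannon_entropy (map_pmf (g i) q))"
proof (rule coupledI[of "pair_pmf p q"])
  have "obs_cost (f i) (g i) (pair_pmf p q) =
      shannon_entropy (map_pmf (f i) p) + shannon_entropy (map_pmf (g i) q)" for i
    using assms
    by (simp add: obs_cost_def map_prod_def map_pair entropy_pair map_fst_pair_pmf map_snd_pair_pmf)
  then show "(\<Sum>i\<in>I. obs_cost (f i) (g i) (pair_pmf p q)) \<le>
     (\<Sum>i\<in>I. shannon_entropy (map_pmf (f i) p) + shannon_entropy (map_pmf (g i) q))" by simp
qed (simp_all add: map_fst_pair_pmf map_snd_pair_pmf)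

text \<open>The old and the new observation determine each other on atoms. The map \<open>e\<close>
  keeps the joint entropy from growing and \<open>d\<close> keeps the marginal entropy from
  dropping. This makes costs insensitive to the way in which the points of a product are
  encoded.\<close>

lemma coupled_transport:
  assumes "coupled I p f q g c" and fin: "finite (set_pmf p)" "finite (set_pmf q)"
    and p': "map_pmf h p = p'"
    and e: "\<And>i x. i \<in> I \<Longrightarrow> x \<in> set_pmf p \<Longrightarrow> f' i (h x) = e i (f i x)"
    and d: "\<And>i x. i \<in> I \<Longrightarrow> x \<in> set_pmf p \<Longrightarrow> f i x = d i (f' i (h x))"
  shows "coupled I p' f' q g c"
proof -
  obtain r where r: "map_pmf fst r = p" "map_pmf snd r = q" "(\<Sum>i\<in>I. obs_cost (f i) (g i) r) \<le> c"
    using assms(1) unfolding coupled_def by blast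
  have finr: "finite (set_pmf r)" by (rule finite_coupling) (use r fin in auto)
  have mem: "fst z \<in> set_pmf p" if "z \<in> set_pmf r" for z using that r(1) by auto
  let ?r = "map_pmf (map_prod h id) r"
  have 1: "map_pmf fst ?r = p'" "map_pmf snd ?r = q"
    using r(1,2) p' by (auto simp: pmf.map_comp o_def)
  have "obs_cost (f' i) (g i) ?r \<le> obs_cost (f i) (g i) r" if i: "i \<in> I" for i
  proof -
    have "shannon_entropy (map_pmf (map_prod (f' i) (g i)) ?r) \<le> shannon_entropy (map_pmf (map_prod (f i) (g i)) r)"
      unfolding pmf.map_comp
      by (rule entropy_map_factor[where e = "map_prod (e i) id"]) (use finr e[OF i] mem in auto)
    moreover have "shannon_entropy (map_pmf (f i) p) \<le> shannon_entropy (map_pmf (f' i) p')"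
      unfolding p'[symmetric] pmf.map_comp
      by (rule entropy_map_factor[where e = "d i"]) (use fin d[OF i] in auto)
    ultimately show ?thesis unfolding obs_cost_def 1 r(1,2) by simp
  qed
  then have "(\<Sum>i\<in>I. obs_cost (f' i) (g i) ?r) \<le> (\<Sum>i\<in>I. obs_cost (f i) (g i) r)"
    by (rule sum_mono)
  with 1 r(3) show ?thesis by (intro coupledI[of ?r]) auto
qed

text \<open>The two couplings are run independently; all three entropies in the cost then
  add.\<close>

lemma coupled_pair:
  assumes "coupled I p1 f1 q1 g1 c1" "coupled I p2 f2 q2 g2 c2"
    and fin: "finite (set_pmf p1)" "finite (set_pmf q1)" "finite (set_pmf p2)" "finite (set_pmf q2)"
  shows "coupled I (pair_pmf p1 p2) (\<lambda>i. map_prod (f1 i) (f2 i))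
    (pair_pmf q1 q2) (\<lambda>i. map_prod (g1 i) (g2 i)) (c1 + c2)"
proof -
  obtain r1 where r1: "map_pmf fst r1 = p1" "map_pmf snd r1 = q1" "(\<Sum>i\<in>I. obs_cost (f1 i) (g1 i) r1) \<le> c1"
    using assms(1) unfolding coupled_def by blast
  obtain r2 where r2: "map_pmf fst r2 = p2" "map_pmf snd r2 = q2" "(\<Sum>i\<in>I. obs_cost (f2 i) (g2 i) r2) \<le> c2"
    using assms(2) unfolding coupled_def by blast
  have finr: "finite (set_pmf r1)" "finite (set_pmf r2)"
    by (rule finite_coupling; use r1 r2 fin in auto)+
  let ?s = "\<lambda>z. ((fst (fst z), fst (snd z)), (snd (fst z), snd (snd z)))"
  let ?r = "map_pmf ?s (pair_pmf r1 r2)"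
  have "map_pmf fst ?r = map_pmf (\<lambda>(a, b). (fst a, fst b)) (pair_pmf r1 r2)"
    by (auto simp: pmf.map_comp intro!: map_pmf_cong)
  then have 1: "map_pmf fst ?r = pair_pmf p1 p2"
    by (simp add: map_pair r1 r2)
  have "map_pmf snd ?r = map_pmf (\<lambda>(a, b). (snd a, snd b)) (pair_pmf r1 r2)"
    by (auto simp: pmf.map_comp intro!: map_pmf_cong)
  then have 2: "map_pmf snd ?r = pair_pmf q1 q2"
    by (simp add: map_pair r1 r2)
  have "obs_cost (map_prod (f1 i) (f2 i)) (map_prod (g1 i) (g2 i)) ?r
     = obs_cost (f1 i) (g1 i) r1 + obs_cost (f2 i) (g2 i) r2" for i
  proof -
    have "map_pmf (map_prod (map_prod (f1 i) (f2 i)) (map_prod (g1 i) (g2 i))) ?r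
      = map_pmf ?s (map_pmf (\<lambda>(a, b). (map_prod (f1 i) (g1 i) a, map_prod (f2 i) (g2 i) b)) (pair_pmf r1 r2))"
      by (auto simp: pmf.map_comp intro!: map_pmf_cong)
    also have "\<dots> = map_pmf ?s (pair_pmf (map_pmf (map_prod (f1 i) (g1 i)) r1) (map_pmf (map_prod (f2 i) (g2 i)) r2))"
      by (simp add: map_pair)
    also have "shannon_entropy \<dots> = shannon_entropy (pair_pmf (map_pmf (map_prod (f1 i) (g1 i)) r1) (map_pmf (map_prod (f2 i) (g2 i)) r2))"
      by (rule shannon_entropy_map_inj) (auto simp: inj_on_def)
    also have "\<dots> = shannon_entropy (map_pmf (map_prod (f1 i) (g1 i)) r1) + shannon_entropy (map_pmf (map_prod (f2 i) (g2 i)) r2)"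
      by (rule entropy_pair) (use finr in auto)
    finally show ?thesis
      unfolding obs_cost_def 1 2 r1(1,2) r2(1,2)
      using fin by (simp add: map_prod_def map_pair entropy_pair)
  qed
  with r1(3) r2(3) show ?thesis
    by (intro coupledI[of ?r] 1 2) (simp add: sum.distrib)
qed

text \<open>The source of the constant 2 |G|. A common label \<open>w\<close> is drawn and its own
  coupling is applied. Forgetting the label raises each joint entropy by at most the entropy of
  \<open>M\<close> over the conditional average, and the joint entropy counts twice; the marginal
  entropies are at least their conditional averages by \<open>entropy_bind_ge\<close>.\<close>

lemma coupled_bind:
  assumes fin: "finite (set_pmf M)" "\<And>w. w \<in> set_pmf M \<Longrightarrow> finite (set_pmf (P w))"
      "\<And>w. w \<in> set_pmf M \<Longrightarrow> finite (set_pmf (Q w))"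
    and c: "\<And>w. w \<in> set_pmf M \<Longrightarrow> coupled I (P w) f (Q w) g (c w)"
  shows "coupled I (bind_pmf M P) f (bind_pmf M Q) g
    (2 * real (card I) * shannon_entropy M + expect M c)"
proof -
  obtain r where r: "map_pmf fst (r w) = P w" "map_pmf snd (r w) = Q w"
    "(\<Sum>i\<in>I. obs_cost (f i) (g i) (r w)) \<le> c w" if "w \<in> set_pmf M" for w
    using c unfolding coupled_def by metis
  have finr: "finite (set_pmf (r w))" if "w \<in> set_pmf M" for w
    by (rule finite_coupling) (use r fin that in auto)
  let ?r = "bind_pmf M r"
  have 1: "map_pmf fst ?r = bind_pmf M P" "map_pmf snd ?r = bind_pmf M Q"
    by (auto simp: map_bind_pmf r intro!: bind_pmf_cong)
  have "obs_cost (f i) (g i) ?r \<le> 2 * shannon_entropy M + expect M (\<lambda>w. obs_cost (f i) (g i) (r w))" for i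
  proof -
    have "shannon_entropy (map_pmf (map_prod (f i) (g i)) ?r)
        \<le> shannon_entropy M + expect M (\<lambda>w. shannon_entropy (map_pmf (map_prod (f i) (g i)) (r w)))"
      unfolding map_bind_pmf by (rule entropy_bind_le) (use fin finr in auto)
    moreover have "expect M (\<lambda>w. shannon_entropy (map_pmf (f i) (P w)))
        \<le> shannon_entropy (map_pmf (f i) (bind_pmf M P))"
      unfolding map_bind_pmf by (rule entropy_bind_ge) (use fin in auto)
    moreover have "expect M (\<lambda>w. shannon_entropy (map_pmf (g i) (Q w)))
        \<le> shannon_entropy (map_pmf (g i) (bind_pmf M Q))"
      unfolding map_bind_pmf by (rule entropy_bind_ge) (use fin in auto)
    moreover have "expect M (\<lambda>w. obs_cost (f i) (g i) (r w)) =
       2 * expect M (\<lambda>w. shannon_entropy (map_pmf (map_prod (f i) (g i)) (r w)))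
       - expect M (\<lambda>w. shannon_entropy (map_pmf (f i) (P w))) - expect M (\<lambda>w. shannon_entropy (map_pmf (g i) (Q w)))"
    proof -
      have "expect M (\<lambda>w. obs_cost (f i) (g i) (r w)) =
        expect M (\<lambda>w. 2 * shannon_entropy (map_pmf (map_prod (f i) (g i)) (r w))
          - shannon_entropy (map_pmf (f i) (P w)) - shannon_entropy (map_pmf (g i) (Q w)))"
        by (rule expect_cong) (simp add: obs_cost_def r)
      then show ?thesis by (simp add: expect_diff[OF fin(1)])
    qed
    ultimately show ?thesis unfolding obs_cost_def[of _ _ ?r] 1 by linarith
  qed
  then have "(\<Sum>i\<in>I. obs_cost (f i) (g i) ?r)
     \<le> (\<Sum>i\<in>I. 2 * shannon_entropy M + expect M (\<lambda>w. obs_cost (f i) (g i) (r w)))"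
    by (rule sum_mono)
  also have "\<dots> = 2 * real (card I) * shannon_entropy M + expect M (\<lambda>w. \<Sum>i\<in>I. obs_cost (f i) (g i) (r w))"
    by (simp add: sum.distrib expect_sum[OF fin(1)])
  also have "\<dots> \<le> 2 * real (card I) * shannon_entropy M + expect M c"
    using r(3) by (intro add_left_mono expect_mono fin(1))
  finally show ?thesis by (intro coupledI[of ?r] 1)
qed

section \<open>Couplings of products\<close>

text \<open>Restricted to \<open>S\<close> in the same way as the arrows of
  \<open>tensor\<close>.\<close>

definition product_obs :: "('o \<Rightarrow> 's \<Rightarrow> 'c) \<Rightarrow> 'k set \<Rightarrow> 'o \<Rightarrow> ('k \<Rightarrow> 's) \<Rightarrow> 'k \<Rightarrow> 'c" where
  "product_obs f S i x = (\<lambda>k\<in>S. f i (x k))"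

text \<open>The index sets of the two sides are unrelated, since the factors of the two tensor
  products differ in number and are indexed by atoms of different spaces.\<close>

definition coupled_products ::
  "'o set \<Rightarrow> ('o \<Rightarrow> 's \<Rightarrow> 'c) \<Rightarrow> ('o \<Rightarrow> 't \<Rightarrow> 'd) \<Rightarrow>
   'k set \<Rightarrow> ('k \<Rightarrow> 's pmf) \<Rightarrow> 'l set \<Rightarrow> ('l \<Rightarrow> 't pmf) \<Rightarrow> real \<Rightarrow> bool" where
  "coupled_products I f g S D R E c \<longleftrightarrow>
     coupled I (Pi_pmf S undefined D) (product_obs f S) (Pi_pmf R undefined E) (product_obs g R) c"

definition obs_entropy :: "'o set \<Rightarrow> ('o \<Rightarrow> 's \<Rightarrow> 'c) \<Rightarrow> 's pmf \<Rightarrow> real" where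
  "obs_entropy I f p = (\<Sum>i\<in>I. shannon_entropy (map_pmf (f i) p))"

lemma obs_entropy_nonneg: "0 \<le> obs_entropy I f p"
  unfolding obs_entropy_def by (intro sum_nonneg entropy_nonneg)

lemma finite_set_Pi_pmf:
  assumes "finite S" "\<And>s. s \<in> S \<Longrightarrow> finite (set_pmf (D s))"
  shows "finite (set_pmf (Pi_pmf S d D))"
  using assms by (subst set_Pi_pmf) auto

lemma Pi_pmf_memD: "finite S \<Longrightarrow> x \<in> set_pmf (Pi_pmf S d D) \<Longrightarrow> k \<in> S \<Longrightarrow> x k \<in> set_pmf (D k)"
  by (auto simp: set_Pi_pmf PiE_dflt_def)

lemma Pi_pmf_outsideD: "finite S \<Longrightarrow> x \<in> set_pmf (Pi_pmf S d D) \<Longrightarrow> k \<notin> S \<Longrightarrow> x k = d"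
  by (auto simp: set_Pi_pmf PiE_dflt_def)

text \<open>The weight of a point is a product over coordinates and hence survives renaming them;
  the relabelling is injective on the support because coordinates outside the index set are pinned
  to \<open>d\<close>.\<close>

lemma Pi_pmf_reindex:
  assumes fin: "finite S" and b: "bij_betw b S S'"
  shows "Pi_pmf S d (\<lambda>s. D (b s)) = map_pmf (\<lambda>x k. if k \<in> S then x (b k) else d) (Pi_pmf S' d D)"
proof (rule pmf_eqI)
  fix y
  let ?h = "\<lambda>x k. if k \<in> S then x (b k) else d"
  have fin': "finite S'" using b fin bij_betw_finite by blast
  \<comment> \<open>The only possible preimage of \<open>y\<close> among the functions that equal
    \<open>d\<close> outside \<open>S'\<close>.\<close>
  let ?y = "\<lambda>k. if k \<in> S' then y (the_inv_into S b k) else d"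
  have inv: "the_inv_into S b (b k) = k" if "k \<in> S" for k
    by (rule the_inv_into_f_f[OF bij_betw_imp_inj_on[OF b] that])
  have bS: "b k \<in> S'" if "k \<in> S" for k by (rule bij_betw_apply[OF b that])
  have inj: "inj_on ?h (set_pmf (Pi_pmf S' d D))"
  proof (rule inj_onI)
    fix x x' assume x: "x \<in> set_pmf (Pi_pmf S' d D)" "x' \<in> set_pmf (Pi_pmf S' d D)" and eq: "?h x = ?h x'"
    show "x = x'"
    proof
      fix k show "x k = x' k"
      proof (cases "k \<in> S'")
        case True
        then obtain s where "s \<in> S" "k = b s" using bij_betw_imp_surj_on[OF b] by blast
        then show ?thesis using fun_cong[OF eq, of s] by simp
      next
        case False then show ?thesis using x[THEN Pi_pmf_outsideD[OF fin']] by simp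
      qed
    qed
  qed
  show "pmf (Pi_pmf S d (\<lambda>s. D (b s))) y = pmf (map_pmf ?h (Pi_pmf S' d D)) y"
  proof (cases "\<forall>k. k \<notin> S \<longrightarrow> y k = d")
    case True
    have hy: "?h ?y = y" using True by (auto simp: inv bS)
    have "pmf (Pi_pmf S' d D) ?y = (\<Prod>k\<in>S'. pmf (D k) (?y k))"
      by (rule pmf_Pi') (use fin' in auto)
    also have "\<dots> = (\<Prod>s\<in>S. pmf (D (b s)) (?y (b s)))"
      by (rule prod.reindex_bij_betw[OF b, symmetric])
    also have "\<dots> = (\<Prod>s\<in>S. pmf (D (b s)) (y s))"
      by (rule prod.cong) (auto simp: inv bS)
    also have "\<dots> = pmf (Pi_pmf S d (\<lambda>s. D (b s))) y"
      using True fin by (simp add: pmf_Pi')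
    finally have e: "pmf (Pi_pmf S d (\<lambda>s. D (b s))) y = pmf (Pi_pmf S' d D) ?y" by simp
    show ?thesis
    proof (cases "?y \<in> set_pmf (Pi_pmf S' d D)")
      case True
      then show ?thesis using pmf_map_inj[OF inj True] e hy by simp
    next
      \<comment> \<open>The weight of \<open>?y\<close> is zero here; \<open>y\<close> must then
        have no preimage in the support at all, as any such preimage would be
        \<open>?y\<close>.\<close>
      case False
      have "y \<notin> ?h ` set_pmf (Pi_pmf S' d D)"
      proof
        assume "y \<in> ?h ` set_pmf (Pi_pmf S' d D)"
        then obtain x where x: "x \<in> set_pmf (Pi_pmf S' d D)" "y = ?h x" by blast
        have "?y = x"
        proof
          fix k show "?y k = x k"
          proof (cases "k \<in> S'")
            case True
            then obtain s where "s \<in> S" "k = b s" using bij_betw_imp_surj_on[OF b] by blast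
            then show ?thesis using x(2) inv True by simp
          next
            case False then show ?thesis using Pi_pmf_outsideD[OF fin' x(1)] by simp
          qed
        qed
        with False x show False by simp
      qed
      then have "pmf (map_pmf ?h (Pi_pmf S' d D)) y = 0" by (auto simp: pmf_eq_0_set_pmf)
      moreover have "pmf (Pi_pmf S' d D) ?y = 0" using False unfolding pmf_eq_0_set_pmf .
      ultimately show ?thesis using e by simp
    qed
  next
    case False
    then have "pmf (Pi_pmf S d (\<lambda>s. D (b s))) y = 0" using fin by (auto intro: pmf_Pi_outside)
    moreover have "pmf (map_pmf ?h (Pi_pmf S' d D)) y = 0"
      using False by (auto simp: pmf_eq_0_set_pmf)
    ultimately show ?thesis by simp
  qed
qed

lemma coupled_products_sym:
  "coupled_products I f g S D R E c \<Longrightarrow> coupled_products I g f R E S D c"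
  unfolding coupled_products_def by (rule coupled_sym)

lemma coupled_products_mono:
  "coupled_products I f g S D R E c \<Longrightarrow> c \<le> c' \<Longrightarrow> coupled_products I f g S D R E c'"
  unfolding coupled_products_def by (rule coupled_mono)

lemma coupled_products_cong:
  assumes "\<And>s. s \<in> S \<Longrightarrow> D s = D' s" "\<And>l. l \<in> R \<Longrightarrow> E l = E' l"
  shows "coupled_products I f g S D R E c \<longleftrightarrow> coupled_products I f g S D' R E' c"
proof -
  have "Pi_pmf S undefined D = Pi_pmf S undefined D'" "Pi_pmf R undefined E = Pi_pmf R undefined E'"
    by (rule Pi_pmf_cong; use assms in simp)+
  then show ?thesis unfolding coupled_products_def by simp
qed

lemma coupled_products_reindex:
  assumes "coupled_products I f g S' D R E c" "finite S" "bij_betw b S S'"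
    and "\<And>s. s \<in> S' \<Longrightarrow> finite (set_pmf (D s))" "finite R" "\<And>l. l \<in> R \<Longrightarrow> finite (set_pmf (E l))"
  shows "coupled_products I f g S (\<lambda>s. D (b s)) R E c"
  unfolding coupled_products_def
proof (rule coupled_transport[where p' = "Pi_pmf S undefined (\<lambda>s. D (b s))"])
  have fin': "finite S'" using assms bij_betw_finite by blast
  show "coupled I (Pi_pmf S' undefined D) (product_obs f S') (Pi_pmf R undefined E) (product_obs g R) c"
    using assms(1) by (simp add: coupled_products_def)
  show "finite (set_pmf (Pi_pmf S' undefined D))" "finite (set_pmf (Pi_pmf R undefined E))"
    using assms fin' by (auto intro!: finite_set_Pi_pmf)
  show "map_pmf (\<lambda>x k. if k \<in> S then x (b k) else undefined) (Pi_pmf S' undefined D)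
    = Pi_pmf S undefined (\<lambda>s. D (b s))"
    by (rule Pi_pmf_reindex[OF assms(2,3), symmetric])
  fix i x
  show "product_obs f S i (\<lambda>k. if k \<in> S then x (b k) else undefined)
     = (\<lambda>y. \<lambda>k\<in>S. y (b k)) (product_obs f S' i x)"
    using assms(3) by (auto simp: product_obs_def restrict_def bij_betw_def)
  have "the_inv_into S b k \<in> S \<and> b (the_inv_into S b k) = k" if "k \<in> S'" for k
    using assms(3) that by (auto simp: bij_betw_def the_inv_into_f_f)
  then show "product_obs f S' i x = (\<lambda>y. \<lambda>k\<in>S'. y (the_inv_into S b k))
     (product_obs f S i (\<lambda>k. if k \<in> S then x (b k) else undefined))"
    by (auto simp: product_obs_def restrict_def)
qed

text \<open>A product over a disjoint union is a pair of products up to encoding, so this is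
  \<open>coupled_pair\<close> transported on both sides.\<close>

lemma coupled_products_Un:
  assumes 1: "coupled_products I f g S1 D R1 E c1" and 2: "coupled_products I f g S2 D R2 E c2"
    and fin: "finite S1" "finite S2" "finite R1" "finite R2"
    and dj: "S1 \<inter> S2 = {}" "R1 \<inter> R2 = {}"
    and finD: "\<And>s. s \<in> S1 \<union> S2 \<Longrightarrow> finite (set_pmf (D s))"
    and finE: "\<And>s. s \<in> R1 \<union> R2 \<Longrightarrow> finite (set_pmf (E s))"
  shows "coupled_products I f g (S1 \<union> S2) D (R1 \<union> R2) E (c1 + c2)"
proof -
  \<comment> \<open>Treats one side only and is polymorphic in all types, so that it also serves the
    other side after \<open>coupled_sym\<close>.\<close>
  have step: "coupled I (Pi_pmf (A \<union> B) undefined D') (product_obs f' (A \<union> B)) q g' c"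
    if c: "coupled I (pair_pmf (Pi_pmf A undefined D') (Pi_pmf B undefined D'))
        (\<lambda>i. map_prod (product_obs f' A i) (product_obs f' B i)) q g' c"
      and fin: "finite A" "finite B" "A \<inter> B = {}" "\<And>s. s \<in> A \<union> B \<Longrightarrow> finite (set_pmf (D' s))"
        "finite (set_pmf q)"
    for A B :: "'m set" and D' :: "'m \<Rightarrow> 'u pmf" and f' :: "'a \<Rightarrow> 'u \<Rightarrow> 'v" and q :: "'w pmf" and g' :: "'a \<Rightarrow> 'w \<Rightarrow> 'z" and c
    using c
  proof (rule coupled_transport)
    show "finite (set_pmf (pair_pmf (Pi_pmf A undefined D') (Pi_pmf B undefined D')))"
      using fin by (auto intro!: finite_set_Pi_pmf finite_cartesian_product)
    show "finite (set_pmf q)" by fact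
    show "map_pmf (\<lambda>(f, g) x. if x \<in> A then f x else g x)
       (pair_pmf (Pi_pmf A undefined D') (Pi_pmf B undefined D')) = Pi_pmf (A \<union> B) undefined D'"
      by (rule Pi_pmf_union[symmetric]) fact+
    fix i x
    show "product_obs f' (A \<union> B) i ((\<lambda>(f, g) x. if x \<in> A then f x else g x) x)
       = (\<lambda>(y, z). \<lambda>k\<in>A \<union> B. if k \<in> A then y k else z k) (map_prod (product_obs f' A i) (product_obs f' B i) x)"
      by (cases x) (auto simp: product_obs_def restrict_def)
    show "map_prod (product_obs f' A i) (product_obs f' B i) x =
       (\<lambda>y. (restrict y A, restrict y B)) (product_obs f' (A \<union> B) i ((\<lambda>(f, g) x. if x \<in> A then f x else g x) x))"
      using fin(3) by (cases x) (auto simp: product_obs_def restrict_def fun_eq_iff)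
  qed
  have P: "coupled I (pair_pmf (Pi_pmf S1 undefined D) (Pi_pmf S2 undefined D))
      (\<lambda>i. map_prod (product_obs f S1 i) (product_obs f S2 i))
     (pair_pmf (Pi_pmf R1 undefined E) (Pi_pmf R2 undefined E))
      (\<lambda>i. map_prod (product_obs g R1 i) (product_obs g R2 i)) (c1 + c2)"
    by (rule coupled_pair) (use 1 2 fin finD finE in \<open>auto simp: coupled_products_def intro!: finite_set_Pi_pmf\<close>)
  have Q: "coupled I (Pi_pmf (S1 \<union> S2) undefined D) (product_obs f (S1 \<union> S2))
     (pair_pmf (Pi_pmf R1 undefined E) (Pi_pmf R2 undefined E))
      (\<lambda>i. map_prod (product_obs g R1 i) (product_obs g R2 i)) (c1 + c2)"
    by (rule step[OF P]) (use fin finD finE dj in \<open>auto intro!: finite_set_Pi_pmf finite_cartesian_product\<close>)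
  show ?thesis
    unfolding coupled_products_def
    by (rule coupled_sym, rule step[OF coupled_sym[OF Q]])
      (use fin finD finE dj in \<open>auto intro!: finite_set_Pi_pmf\<close>)
qed

lemma coupled_products_empty: "coupled_products I f g {} D {} E 0"
  unfolding coupled_products_def
  using coupled_indep[of "return_pmf (\<lambda>_. undefined)" "return_pmf (\<lambda>_. undefined)" I "product_obs f {}" "product_obs g {}"]
  by simp

lemma coupled_products_single:
  assumes "coupled I (D s) f (E l) g c" "finite (set_pmf (D s))" "finite (set_pmf (E l))"
  shows "coupled_products I f g {s} D {l} E c"
proof -
  have step: "coupled I (Pi_pmf {k} undefined D') (product_obs f' {k}) q g' c"
    if c: "coupled I (D' k) f' q g' c" and fin: "finite (set_pmf (D' k))" "finite (set_pmf q)"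
    for k :: 'm and D' :: "'m \<Rightarrow> 'u pmf" and f' :: "'a \<Rightarrow> 'u \<Rightarrow> 'v" and q :: "'w pmf" and g' :: "'a \<Rightarrow> 'w \<Rightarrow> 'z" and c
    by (rule coupled_transport[OF c fin Pi_pmf_singleton[where x = k and p = D' and dflt = undefined, symmetric],
          where e = "\<lambda>i y. \<lambda>j\<in>{k}. y" and d = "\<lambda>i y. y k"])
       (auto simp: product_obs_def restrict_def)
  have Q: "coupled I (Pi_pmf {s} undefined D) (product_obs f {s}) (E l) g c"
    by (rule step) fact+
  show ?thesis
    unfolding coupled_products_def
    by (rule coupled_sym, rule step, rule coupled_sym, rule Q)
      (use assms in \<open>auto intro!: finite_set_Pi_pmf\<close>)
qed

text \<open>The price of factors left without partner. The empty product is a single point, so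
  nothing but their own entropies is paid.\<close>

lemma coupled_products_left:
  fixes E :: "'l \<Rightarrow> 't pmf"
  assumes "finite S" "\<And>s. s \<in> S \<Longrightarrow> finite (set_pmf (D s))"
  shows "coupled_products I f g S D {} E (\<Sum>s\<in>S. obs_entropy I f (D s))"
  using assms
proof (induction S)
  case empty
  then show ?case using coupled_products_empty by simp
next
  case (insert s S)
  have "coupled_products I f g {s} D {} E (obs_entropy I f (D s))"
  proof -
    have "coupled I (Pi_pmf {s} undefined D) (product_obs f {s}) (Pi_pmf {} undefined E) (product_obs g {})
     (\<Sum>i\<in>I. shannon_entropy (map_pmf (product_obs f {s} i) (Pi_pmf {s} undefined D)) +
       shannon_entropy (map_pmf (product_obs g ({} :: 'l set) i) (Pi_pmf {} undefined E)))"
      by (rule coupled_indep) (use insert in \<open>auto intro!: finite_set_Pi_pmf\<close>)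
    moreover have "shannon_entropy (map_pmf (product_obs f {s} i) (Pi_pmf {s} undefined D))
       \<le> shannon_entropy (map_pmf (f i) (D s))" for i
      unfolding Pi_pmf_singleton pmf.map_comp
      by (rule entropy_map_factor[where e = "\<lambda>y. \<lambda>j\<in>{s}. y"])
         (use insert in \<open>auto simp: product_obs_def restrict_def\<close>)
    ultimately show ?thesis
      unfolding coupled_products_def
      by (auto simp: obs_entropy_def elim!: coupled_mono intro!: sum_mono)
  qed
  from coupled_products_Un[OF this insert.IH] insert show ?case by auto
qed


lemma card_Collect_insert:
  assumes "finite S" "s \<notin> S"
  shows "card {x \<in> insert s S. \<tau> x = c} = card {x \<in> S. \<tau> x = c} + (if c = \<tau> s then 1 else 0)"
proof (cases "c = \<tau> s")
  case True
  then have "{x \<in> insert s S. \<tau> x = c} = insert s {x \<in> S. \<tau> x = c}" by auto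
  then show ?thesis using assms True by simp
next
  case False
  then have "{x \<in> insert s S. \<tau> x = c} = {x \<in> S. \<tau> x = c}" by auto
  then show ?thesis using False by simp
qed

text \<open>Greedy matching by induction on \<open>S\<close>: a factor takes any remaining partner
  of its class and pays \<kappa>, or stays alone and pays \<open>B\<close>. The bound charges
  \<kappa> for every factor of \<open>S\<close>, matched or not, which makes this part linear in the
  counts and easy to average; the absolute differences count the factors left over on either
  side.\<close>

lemma coupled_products_matching:
  fixes \<tau> :: "'k \<Rightarrow> 'c" and \<tau>' :: "'l \<Rightarrow> 'c"
  assumes fin: "finite S" "finite R" "finite C"
    and C: "\<tau> ` S \<subseteq> C" "\<tau>' ` R \<subseteq> C"
    and finP: "\<And>c. c \<in> C \<Longrightarrow> finite (set_pmf (P c))" "\<And>c. c \<in> C \<Longrightarrow> finite (set_pmf (Q c))"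
    and \<kappa>: "\<And>c. c \<in> C \<Longrightarrow> coupled I (P c) f (Q c) g (\<kappa> c)" "\<And>c. c \<in> C \<Longrightarrow> 0 \<le> \<kappa> c"
    and B: "\<And>c. c \<in> C \<Longrightarrow> obs_entropy I f (P c) \<le> B" "\<And>c. c \<in> C \<Longrightarrow> obs_entropy I g (Q c) \<le> B"
  shows "coupled_products I f g S (\<lambda>s. P (\<tau> s)) R (\<lambda>l. Q (\<tau>' l))
    (\<Sum>c\<in>C. real (card {s \<in> S. \<tau> s = c}) * \<kappa> c
       + B * \<bar>real (card {s \<in> S. \<tau> s = c}) - real (card {l \<in> R. \<tau>' l = c})\<bar>)"
    (is "coupled_products I f g S _ R _ (?F S R)")
  using fin(1,2) C
proof (induction S arbitrary: R rule: finite_induct)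
  case empty
  have "coupled_products I g f R (\<lambda>l. Q (\<tau>' l)) ({} :: 'k set) (\<lambda>s. P (\<tau> s))
     (\<Sum>l\<in>R. obs_entropy I g (Q (\<tau>' l)))"
    by (rule coupled_products_left) (use empty finP in auto)
  moreover have "(\<Sum>l\<in>R. obs_entropy I g (Q (\<tau>' l))) \<le> ?F {} R"
  proof -
    have "(\<Sum>l\<in>R. obs_entropy I g (Q (\<tau>' l))) \<le> (\<Sum>l\<in>R. B)"
      by (rule sum_mono) (use B empty in auto)
    also have "\<dots> = (\<Sum>c\<in>C. \<Sum>l\<in>{l \<in> R. \<tau>' l = c}. B)"
      by (rule sum.group[symmetric]) (use fin empty in auto)
    also have "\<dots> = ?F {} R" by (simp add: mult.commute)
    finally show ?thesis .
  qed
  ultimately show ?case by (blast intro: coupled_products_sym coupled_products_mono)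
next
  case (insert s S)
  have sC: "\<tau> s \<in> C" using insert by auto
  show ?case
  proof (cases "\<exists>l\<in>R. \<tau>' l = \<tau> s")
    case True
    then obtain l where l: "l \<in> R" "\<tau>' l = \<tau> s" by blast
    define R' where "R' = R - {l}"
    have R: "R = insert l R'" "l \<notin> R'" "finite R'" using l insert by (auto simp: R'_def)
    have "coupled_products I f g {s} (\<lambda>s. P (\<tau> s)) {l} (\<lambda>l. Q (\<tau>' l)) (\<kappa> (\<tau> s))"
      by (rule coupled_products_single) (use l sC \<kappa> finP in auto)
    moreover have "coupled_products I f g S (\<lambda>s. P (\<tau> s)) R' (\<lambda>l. Q (\<tau>' l)) (?F S R')"
      by (rule insert.IH) (use insert.prems R in auto)
    ultimately have "coupled_products I f g ({s} \<union> S) (\<lambda>s. P (\<tau> s)) ({l} \<union> R') (\<lambda>l. Q (\<tau>' l)) (\<kappa> (\<tau> s) + ?F S R')"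
      by (rule coupled_products_Un) (use insert.prems insert.hyps R finP in auto)
    \<comment> \<open>Removing a matched pair lowers both counts of its class by one and leaves
      their difference alone.\<close>
    moreover have "?F (insert s S) (insert l R') = \<kappa> (\<tau> s) + ?F S R'"
    proof -
      have "?F (insert s S) (insert l R') = (\<Sum>c\<in>C. (if c = \<tau> s then \<kappa> c else 0) +
         (real (card {s \<in> S. \<tau> s = c}) * \<kappa> c
         + B * \<bar>real (card {s \<in> S. \<tau> s = c}) - real (card {l \<in> R'. \<tau>' l = c})\<bar>))"
        by (intro sum.cong refl, unfold card_Collect_insert[OF insert.hyps] card_Collect_insert[OF R(3,2)] l(2))
          (simp add: algebra_simps)
      then show ?thesis using sC fin by (simp add: sum.distrib[of "\<lambda>c. if _ c then _ c else 0"])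
    qed
    ultimately show ?thesis using R by simp
  next
    case False
    have "coupled_products I f g {s} (\<lambda>s. P (\<tau> s)) {} (\<lambda>l. Q (\<tau>' l)) (\<Sum>s\<in>{s}. obs_entropy I f (P (\<tau> s)))"
      by (rule coupled_products_left) (use sC finP in auto)
    then have "coupled_products I f g {s} (\<lambda>s. P (\<tau> s)) {} (\<lambda>l. Q (\<tau>' l)) B"
      by (rule coupled_products_mono) (use B sC in auto)
    moreover have "coupled_products I f g S (\<lambda>s. P (\<tau> s)) R (\<lambda>l. Q (\<tau>' l)) (?F S R)"
      by (rule insert.IH) (use insert.prems in auto)
    ultimately have "coupled_products I f g ({s} \<union> S) (\<lambda>s. P (\<tau> s)) ({} \<union> R) (\<lambda>l. Q (\<tau>' l)) (B + ?F S R)"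
      by (rule coupled_products_Un) (use insert.prems insert.hyps finP in auto)
    moreover have "?F (insert s S) R = \<kappa> (\<tau> s) + B + ?F S R"
    proof -
      \<comment> \<open>The count in \<open>R\<close> is zero for this class, so the absolute
        difference grows by exactly one. The bound also contains \<kappa> for the unmatched factor,
        which is given away by nonnegativity.\<close>
      have e: "{l \<in> R. \<tau>' l = \<tau> s} = {}" using False by auto
      have "?F (insert s S) R = (\<Sum>c\<in>C. (if c = \<tau> s then \<kappa> c + B else 0) +
         (real (card {s \<in> S. \<tau> s = c}) * \<kappa> c
         + B * \<bar>real (card {s \<in> S. \<tau> s = c}) - real (card {l \<in> R. \<tau>' l = c})\<bar>))"
        by (intro sum.cong refl, unfold card_Collect_insert[OF insert.hyps])
          (auto simp: e algebra_simps)
      then show ?thesis using sC fin by (simp add: sum.distrib[of "\<lambda>c. if _ c then _ c else 0"])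
    qed
    ultimately show ?thesis using \<kappa>(2)[OF sC] by (auto elim: coupled_products_mono)
  qed
qed

section \<open>Flattening a tensor product of tensor powers\<close>

lemma Pi_pmf_map_dep:
  assumes "finite A"
  shows "Pi_pmf A d' (\<lambda>k. map_pmf (f k) (p k)) = map_pmf (\<lambda>x k. if k \<in> A then f k (x k) else d') (Pi_pmf A d p)"
proof -
  have "Pi_pmf A d' (\<lambda>k. map_pmf (f k) (p k)) = Pi_pmf A d' (\<lambda>k. bind_pmf (p k) (\<lambda>y. return_pmf (f k y)))"
    by (simp add: map_pmf_def)
  also have "\<dots> = bind_pmf (Pi_pmf A d p) (\<lambda>x. Pi_pmf A d' (\<lambda>k. return_pmf (f k (x k))))"
    by (rule Pi_pmf_bind[OF assms])
  also have "\<dots> = map_pmf (\<lambda>x k. if k \<in> A then f k (x k) else d') (Pi_pmf A d p)"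
    using assms by (simp add: map_pmf_def)
  finally show ?thesis .
qed

text \<open>Currying an independent family. The induction splits off the block over one
  \<open>u\<close>, which is a renamed copy of a product over \<open>B u\<close>.\<close>

lemma Pi_pmf_Sigma:
  assumes "finite U" "\<And>u. u \<in> U \<Longrightarrow> finite (B u)"
  shows "map_pmf (\<lambda>x. \<lambda>u\<in>U. \<lambda>j\<in>B u. x (u, j)) (Pi_pmf (Sigma U B) undefined D)
    = Pi_pmf U undefined (\<lambda>u. Pi_pmf (B u) undefined (\<lambda>j. D (u, j)))"
  using assms
proof (induction U)
  case empty
  then show ?case by (simp add: restrict_def)
next
  case (insert u U)
  let ?F = "Pi_pmf ({u} \<times> B u) undefined D"
  let ?G = "Pi_pmf (Sigma U B) undefined D"
  have fin: "finite ({u} \<times> B u)" "finite (Sigma U B)" "finite (B u)" using insert by auto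
  have IH: "map_pmf (\<lambda>x. \<lambda>u\<in>U. \<lambda>j\<in>B u. x (u, j)) ?G
      = Pi_pmf U undefined (\<lambda>u. Pi_pmf (B u) undefined (\<lambda>j. D (u, j)))"
    by (rule insert.IH) (use insert.prems in auto)
  have 1: "Pi_pmf (B u) undefined (\<lambda>j. D (u, j)) = map_pmf (\<lambda>x k. if k \<in> B u then x (u, k) else undefined) ?F"
    by (rule Pi_pmf_reindex) (use fin in \<open>auto simp: bij_betw_def inj_on_def\<close>)
  have 2: "Pi_pmf (Sigma (insert u U) B) undefined D = map_pmf (\<lambda>(f, g) x. if x \<in> {u} \<times> B u then f x else g x)
        (pair_pmf ?F ?G)"
  proof -
    have "Sigma (insert u U) B = ({u} \<times> B u) \<union> Sigma U B" by auto
    then show ?thesis using Pi_pmf_union[OF fin(1,2), of undefined D] insert.hyps by auto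
  qed
  have "Pi_pmf (insert u U) undefined (\<lambda>u. Pi_pmf (B u) undefined (\<lambda>j. D (u, j)))
    = map_pmf (\<lambda>(y, f). f(u := y)) (pair_pmf
      (map_pmf (\<lambda>x k. if k \<in> B u then x (u, k) else undefined) ?F)
      (map_pmf (\<lambda>x. \<lambda>u\<in>U. \<lambda>j\<in>B u. x (u, j)) ?G))"
    using Pi_pmf_insert[OF insert.hyps, of undefined "\<lambda>u. Pi_pmf (B u) undefined (\<lambda>j. D (u, j))"]
    by (simp only: 1 IH)
  also have "\<dots> = map_pmf (\<lambda>(y, f). f(u := y)) (map_pmf (\<lambda>(x, y). (\<lambda>k. if k \<in> B u then x (u, k) else undefined,
       \<lambda>u\<in>U. \<lambda>j\<in>B u. y (u, j))) (pair_pmf ?F ?G))"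
    by (simp only: map_pair)
  also have "\<dots> = map_pmf (\<lambda>x. \<lambda>u\<in>insert u U. \<lambda>j\<in>B u. x (u, j)) (Pi_pmf (Sigma (insert u U) B) undefined D)"
    unfolding 2 pmf.map_comp
    by (rule map_pmf_cong[OF refl]) (use insert.hyps in \<open>auto simp: restrict_def fun_eq_iff\<close>)
  finally show ?case by (rule sym)
qed

text \<open>The shape of the arrows of \<open>tropical_cond\<close>, a tensor product of tensor
  powers.\<close>

definition nested_obs where
  "nested_obs f U B i x = (\<lambda>u\<in>U. \<lambda>j\<in>B u. f i (x u j))"

text \<open>Currying and uncurrying translate the observations into each other, so
  \<open>coupled_transport\<close> applies in both directions and all matching can be done on flat
  families.\<close>

lemma coupled_nested_iff:
  assumes fin: "finite U" "\<And>u. u \<in> U \<Longrightarrow> finite (B u)" "\<And>s. s \<in> Sigma U B \<Longrightarrow> finite (set_pmf (D s))"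
    "finite (set_pmf q)"
  shows "coupled I (Pi_pmf U undefined (\<lambda>u. Pi_pmf (B u) undefined (\<lambda>j. D (u, j)))) (nested_obs f U B) q g c
    \<longleftrightarrow> coupled I (Pi_pmf (Sigma U B) undefined D) (product_obs f (Sigma U B)) q g c"
    (is "coupled I ?N _ q g c \<longleftrightarrow> coupled I ?P _ q g c")
proof
  have finS: "finite (Sigma U B)" using fin by auto
  have finN: "finite (set_pmf ?N)"
    using fin by (intro finite_set_Pi_pmf) auto
  have finP: "finite (set_pmf ?P)"
    using fin by (intro finite_set_Pi_pmf) auto
  let ?h = "\<lambda>x. \<lambda>u\<in>U. \<lambda>j\<in>B u. x (u, j)"
  let ?h' = "\<lambda>y. \<lambda>(u, j)\<in>Sigma U B. y u j"
  have hh': "?h' (?h x) = x" if "x \<in> set_pmf ?P" for x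
    using Pi_pmf_outsideD[OF finS that] by (auto simp: restrict_def fun_eq_iff)
  have P: "map_pmf ?h ?P = ?N" by (rule Pi_pmf_Sigma[OF fin(1,2)])
  have N: "map_pmf ?h' ?N = ?P"
  proof -
    have "map_pmf ?h' ?N = map_pmf (\<lambda>x. ?h' (?h x)) ?P"
      unfolding P[symmetric] pmf.map_comp o_def ..
    also have "\<dots> = map_pmf (\<lambda>x. x) ?P" by (rule map_pmf_cong[OF refl]) (rule hh')
    finally show ?thesis by simp
  qed
  show "coupled I ?P (product_obs f (Sigma U B)) q g c" if "coupled I ?N (nested_obs f U B) q g c"
    by (rule coupled_transport[OF that finN fin(4) N, where e = "\<lambda>i. ?h'" and d = "\<lambda>i. ?h"])
      (auto simp: nested_obs_def product_obs_def restrict_def fun_eq_iff)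
  show "coupled I ?N (nested_obs f U B) q g c" if "coupled I ?P (product_obs f (Sigma U B)) q g c"
    by (rule coupled_transport[OF that finP fin(4) P, where e = "\<lambda>i. ?h" and d = "\<lambda>i. ?h'"])
      (auto simp: nested_obs_def product_obs_def restrict_def fun_eq_iff)
qed

text \<open>One index (atom, copy number) for each factor of the diagram that represents the
  tropical conditioning at stage \<open>n\<close>.\<close>

definition quota_sites :: "'c pmf \<Rightarrow> nat \<Rightarrow> ('c \<times> nat) set" where
  "quota_sites p n = Sigma (set_pmf p) (\<lambda>u. {..<nat \<lfloor>real n * pmf p u\<rfloor>})"

lemma finite_quota_sites: "finite (set_pmf p) \<Longrightarrow> finite (quota_sites p n)"
  by (simp add: quota_sites_def)

lemma fst_quota_sites: "s \<in> quota_sites p n \<Longrightarrow> fst s \<in> set_pmf p"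
  by (auto simp: quota_sites_def)

lemma is_diagram_tensor:
  assumes C: "is_category C" and fin: "finite J" and F: "\<And>k. k \<in> J \<Longrightarrow> is_diagram C (F k)"
  shows "is_diagram C (tensor J F)"
  unfolding is_diagram_def is_reduction_def
proof (intro conjI ballI impI)
  let ?T = "tensor J F"
  have spcT: "spc ?T i = Pi_pmf J undefined (\<lambda>k. spc (F k) i)" for i by (simp add: tensor_def)
  have arrT: "arr ?T m x = (\<lambda>k\<in>J. arr (F k) m (x k))" for m x by (simp add: tensor_def)
  fix i assume i: "i \<in> Obj C"
  show "finite (set_pmf (spc ?T i))"
    unfolding spcT using fin F i by (intro finite_set_Pi_pmf) (auto simp: is_diagram_def)
  show "AE x in measure_pmf (spc ?T i). arr ?T (ident C i) x = x"
    unfolding AE_measure_pmf_iff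
  proof
    fix x assume x: "x \<in> set_pmf (spc ?T i)"
    show "arr ?T (ident C i) x = x"
    proof
      fix k
      have "arr (F k) (ident C i) (x k) = x k" if "k \<in> J"
        using F[OF that] i Pi_pmf_memD[OF fin x[unfolded spcT] that]
        by (auto simp: is_diagram_def AE_measure_pmf_iff)
      \<comment> \<open>Outside \<open>J\<close> the restriction returns \<open>undefined\<close>,
        and so does every atom of the product.\<close>
      then show "arr ?T (ident C i) x k = x k"
        using Pi_pmf_outsideD[OF fin x[unfolded spcT]] by (auto simp: arrT)
    qed
  qed
next
  let ?T = "tensor J F"
  have spcT: "spc ?T i = Pi_pmf J undefined (\<lambda>k. spc (F k) i)" for i by (simp add: tensor_def)
  have arrT: "arr ?T m x = (\<lambda>k\<in>J. arr (F k) m (x k))" for m x by (simp add: tensor_def)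
  fix m assume m: "m \<in> Mor C"
  show "map_pmf (arr ?T m) (spc ?T (src C m)) = spc ?T (tgt C m)"
  proof -
    have "spc ?T (tgt C m) = Pi_pmf J undefined (\<lambda>k. map_pmf (arr (F k) m) (spc (F k) (src C m)))"
      unfolding spcT using F m by (intro Pi_pmf_cong refl) (auto simp: is_diagram_def is_reduction_def)
    also have "\<dots> = map_pmf (arr ?T m) (spc ?T (src C m))"
      unfolding spcT by (subst Pi_pmf_map_dep[OF fin, where d = undefined]) (auto simp: arrT restrict_def intro!: map_pmf_cong)
    finally show ?thesis by simp
  qed
  fix m' assume m': "m' \<in> Mor C" "tgt C m = src C m'"
  show "AE x in measure_pmf (spc ?T (src C m)). arr ?T (compose C m' m) x = arr ?T m' (arr ?T m x)"
    unfolding AE_measure_pmf_iff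
  proof
    fix x assume x: "x \<in> set_pmf (spc ?T (src C m))"
    have "arr (F k) (compose C m' m) (x k) = arr (F k) m' (arr (F k) m (x k))" if "k \<in> J" for k
      using F[OF that] m m' Pi_pmf_memD[OF fin x[unfolded spcT] that]
      by (auto simp: is_diagram_def AE_measure_pmf_iff)
    then show "arr ?T (compose C m' m) x = arr ?T m' (arr ?T m x)"
      by (auto simp: arrT)
  qed
qed

section \<open>Diagrams generated by their initial space\<close>

lemma is_diagram_map:
  "is_diagram C X \<Longrightarrow> m \<in> Mor C \<Longrightarrow> map_pmf (arr X m) (spc X (src C m)) = spc X (tgt C m)"
  by (simp add: is_diagram_def is_reduction_def)

lemma is_diagram_reduction_natural:
  "is_diagram_reduction C \<phi> X Y \<Longrightarrow> m \<in> Mor C \<Longrightarrow> x \<in> set_pmf (spc X (src C m)) \<Longrightarrow>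
    arr Y m (\<phi> (src C m) x) = \<phi> (tgt C m) (arr X m x)"
  by (simp add: is_diagram_reduction_def AE_measure_pmf_iff)

text \<open>Taking common ancestors repeatedly through the finite set of objects yields an ancestor
  of all of them. Uniqueness, both of the morphisms and of the object itself, comes from the bound
  on morphisms either way.\<close>

lemma initial_object:
  assumes G: "indexing_category G" and ne: "Obj G \<noteq> {}"
  shows "initial_object G \<in> Obj G \<and> (\<forall>j\<in>Obj G. \<exists>!f. f \<in> hom_set G (initial_object G) j)"
  unfolding initial_object_def
proof (rule theI')
  note G' = G[unfolded indexing_category_def]
  have cat: "is_category G" and fin: "finite (Obj G)" using G' by blast+
  have uniq: "f = g" if "i \<in> Obj G" "j \<in> Obj G" "f \<in> hom_set G i j \<union> hom_set G j i"
    "g \<in> hom_set G i j \<union> hom_set G j i" for i j f g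
    using G' that by blast
  have "\<forall>i\<in>Obj G. \<forall>j\<in>Obj G. \<exists>h. minimal_common_ancestor G h i j"
    using G' by (elim conjE)
  then have mca: "\<exists>h. minimal_common_ancestor G h i j" if "i \<in> Obj G" "j \<in> Obj G" for i j
    using that by (elim ballE[where x = i] ballE[where x = j]) auto
  have trans: "ancestor G i k" if anc: "ancestor G i j" "ancestor G j k" for i j k
  proof -
    obtain f g where fg: "f \<in> hom_set G i j" "g \<in> hom_set G j k" using anc unfolding ancestor_def by blast
    then have "compose G g f \<in> hom_set G i k" using cat by (auto simp: is_category_def hom_set_def)
    then show ?thesis by (auto simp: ancestor_def)
  qed
  have "\<exists>z\<in>Obj G. \<forall>j\<in>A. ancestor G z j" if "finite A" "A \<noteq> {}" "A \<subseteq> Obj G" for A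
    using that
  proof (induction A rule: finite_ne_induct)
    case (singleton x)
    then have "ident G x \<in> hom_set G x x" using cat by (auto simp: is_category_def)
    then show ?case using singleton by (auto simp: ancestor_def)
  next
    case (insert x A)
    then obtain z where z: "z \<in> Obj G" "\<forall>j\<in>A. ancestor G z j" by auto
    obtain h where "minimal_common_ancestor G h z x" using mca z insert by blast
    then have "h \<in> Obj G" "ancestor G h z" "ancestor G h x" by (auto simp: minimal_common_ancestor_def)
    then show ?case using z trans by blast
  qed
  from this[OF fin ne] obtain z where z: "z \<in> Obj G" "\<And>j. j \<in> Obj G \<Longrightarrow> ancestor G z j" by auto
  have u: "\<exists>!f. f \<in> hom_set G z j" if j: "j \<in> Obj G" for j
  proof -
    obtain f where "f \<in> hom_set G z j" using z(2)[OF j] unfolding ancestor_def by blast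
    then show ?thesis using uniq[OF z(1) j] by blast
  qed
  show "\<exists>!z. z \<in> Obj G \<and> (\<forall>j\<in>Obj G. \<exists>!f. f \<in> hom_set G z j)"
  proof (rule ex1I[of _ z])
    show "z \<in> Obj G \<and> (\<forall>j\<in>Obj G. \<exists>!f. f \<in> hom_set G z j)" using z u by blast
    fix z' assume z': "z' \<in> Obj G \<and> (\<forall>j\<in>Obj G. \<exists>!f. f \<in> hom_set G z' j)"
    obtain f where f: "f \<in> hom_set G z z'"
      using z(2)[OF conjunct1[OF z']] unfolding ancestor_def by blast
    obtain g where g: "g \<in> hom_set G z' z"
      using ex1_implies_ex[OF bspec[OF conjunct2[OF z'] z(1)]] by blast
    \<comment> \<open>Morphisms in opposite directions between the same two objects coincide, hence
      so do their sources \<open>z\<close> and \<open>z'\<close>.\<close>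
    have "f = g" by (rule uniq[OF z(1) conjunct1[OF z']]) (simp_all add: f g)
    moreover have "src G f = z" "src G g = z'" using f g by (simp_all add: hom_set_def)
    ultimately show "z' = z" by simp
  qed
qed

locale indexed =
  fixes G :: "('o, 'm) small_cat" and \<iota> :: 'o
  assumes indexing: "indexing_category G" and \<iota>: "\<iota> \<in> Obj G"
begin

definition init_obj :: 'o where "init_obj = initial_object G"

definition from_initial :: "('o, 'm, 's) diagram \<Rightarrow> 'o \<Rightarrow> 's \<Rightarrow> 's" where
  "from_initial X i = arr X (the_mor G init_obj i)"

lemma cat: "is_category G"
  using indexing unfolding indexing_category_def by blast

lemma finite_Obj: "finite (Obj G)"
  using indexing unfolding indexing_category_def by blast

lemma init_obj: "init_obj \<in> Obj G" and init_obj_hom: "j \<in> Obj G \<Longrightarrow> \<exists>!f. f \<in> hom_set G init_obj j"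
  unfolding init_obj_def using initial_object[OF indexing] \<iota> by blast+

lemma the_mor: "j \<in> Obj G \<Longrightarrow> the_mor G init_obj j \<in> hom_set G init_obj j"
  unfolding the_mor_def by (rule theI'[OF init_obj_hom])

lemma the_mor_eq: "j \<in> Obj G \<Longrightarrow> f \<in> hom_set G init_obj j \<Longrightarrow> the_mor G init_obj j = f"
  unfolding the_mor_def by (rule the1_equality[OF init_obj_hom])

lemma the_mor_props:
  assumes "j \<in> Obj G"
  shows "the_mor G init_obj j \<in> Mor G" "src G (the_mor G init_obj j) = init_obj" "tgt G (the_mor G init_obj j) = j"
  using the_mor[OF assms] by (auto simp: hom_set_def)

lemma spc_from_initial:
  assumes "is_diagram G X" "i \<in> Obj G"
  shows "map_pmf (from_initial X i) (spc X init_obj) = spc X i"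
  using is_diagram_map[OF assms(1) the_mor_props(1)[OF assms(2)]]
  by (simp add: the_mor_props[OF assms(2)] from_initial_def)

lemma from_initial_mem:
  assumes "is_diagram G X" "i \<in> Obj G" "x \<in> set_pmf (spc X init_obj)"
  shows "from_initial X i x \<in> set_pmf (spc X i)"
  using assms(3) unfolding spc_from_initial[OF assms(1,2), symmetric] by simp

lemma from_initial_init_obj:
  assumes "is_diagram G X" "x \<in> set_pmf (spc X init_obj)"
  shows "from_initial X init_obj x = x"
proof -
  have "the_mor G init_obj init_obj = ident G init_obj"
    using cat init_obj by (intro the_mor_eq) (auto simp: is_category_def)
  then show ?thesis using assms init_obj by (auto simp: from_initial_def is_diagram_def AE_measure_pmf_iff)
qed

text \<open>By uniqueness of morphisms out of the initial object, the map to the target is the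
  composite through the source. The functor law carries this over to atoms.\<close>

lemma from_initial_arr:
  assumes X: "is_diagram G X" and m: "m \<in> Mor G" and x: "x \<in> set_pmf (spc X init_obj)"
  shows "arr X m (from_initial X (src G m) x) = from_initial X (tgt G m) x"
proof -
  have st: "src G m \<in> Obj G" "tgt G m \<in> Obj G" using cat m by (auto simp: is_category_def)
  note p = the_mor_props[OF st(1)]
  have "compose G m (the_mor G init_obj (src G m)) \<in> hom_set G (src G (the_mor G init_obj (src G m))) (tgt G m)"
    using cat m p(1,3) by (simp add: is_category_def)
  then have "compose G m (the_mor G init_obj (src G m)) \<in> hom_set G init_obj (tgt G m)" by (simp only: p(2))
  then have "the_mor G init_obj (tgt G m) = compose G m (the_mor G init_obj (src G m))"
    by (rule the_mor_eq[OF st(2)])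
  moreover have "arr X (compose G m (the_mor G init_obj (src G m))) x = arr X m (arr X (the_mor G init_obj (src G m)) x)"
    using X m p x by (auto simp: is_diagram_def AE_measure_pmf_iff)
  ultimately show ?thesis by (simp add: from_initial_def)
qed

lemma finite_spc: "is_diagram G X \<Longrightarrow> i \<in> Obj G \<Longrightarrow> finite (set_pmf (spc X i))"
  by (simp add: is_diagram_def)

text \<open>A coupling of the initial spaces generates a fan, its images in the products of the other spaces.\<close>

lemma entropy_dist_le_coupled:
  assumes X: "is_diagram G X" and Y: "is_diagram G Y"
    and c: "coupled (Obj G) (spc X init_obj) (from_initial X) (spc Y init_obj) (from_initial Y) c"
  shows "entropy_dist G X Y \<le> c"
proof -
  obtain r where r: "map_pmf fst r = spc X init_obj" "map_pmf snd r = spc Y init_obj"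
    "(\<Sum>i\<in>Obj G. obs_cost (from_initial X i) (from_initial Y i) r) \<le> c"
    using c unfolding coupled_def by blast
  have finr: "finite (set_pmf r)" by (rule finite_coupling) (use r X Y init_obj in \<open>auto simp: finite_spc\<close>)
  have mem: "fst w \<in> set_pmf (spc X init_obj)" "snd w \<in> set_pmf (spc Y init_obj)" if "w \<in> set_pmf r" for w
    unfolding r(1,2)[symmetric] using that by auto
  define Z where "Z = \<lparr>spc = (\<lambda>i. map_pmf (map_prod (from_initial X i) (from_initial Y i)) r),
      arr = (\<lambda>m. map_prod (arr X m) (arr Y m))\<rparr>"
  have arrZ: "arr Z m (map_prod (from_initial X (src G m)) (from_initial Y (src G m)) w)
      = map_prod (from_initial X (tgt G m)) (from_initial Y (tgt G m)) w"
    if "m \<in> Mor G" "w \<in> set_pmf r" for m w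
    using mem[OF that(2)] from_initial_arr[OF X that(1)] from_initial_arr[OF Y that(1)]
    by (cases w) (simp add: Z_def)
  have st: "src G (ident G i) = i \<and> tgt G (ident G i) = i \<and> ident G i \<in> Mor G" if "i \<in> Obj G" for i
    using cat that by (auto simp: is_category_def hom_set_def)
  have co: "src G (compose G g f) = src G f \<and> tgt G (compose G g f) = tgt G g \<and> compose G g f \<in> Mor G"
    if "f \<in> Mor G" "g \<in> Mor G" "tgt G f = src G g" for f g
    using cat that by (auto simp: is_category_def hom_set_def)
  have spcZ: "spc Z i = map_pmf (map_prod (from_initial X i) (from_initial Y i)) r" for i
    by (simp add: Z_def)
  have dia: "is_diagram G Z"
    unfolding is_diagram_def is_reduction_def
  proof (intro conjI ballI impI)
    show "finite (set_pmf (spc Z i))" for i using finr by (simp add: spcZ)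
    show "map_pmf (arr Z f) (spc Z (src G f)) = spc Z (tgt G f)" if "f \<in> Mor G" for f
      unfolding spcZ pmf.map_comp by (rule map_pmf_cong[OF refl]) (simp add: arrZ that)
    show "AE x in measure_pmf (spc Z i). arr Z (ident G i) x = x" if "i \<in> Obj G" for i
      using arrZ[of "ident G i"] st[OF that] by (auto simp: AE_measure_pmf_iff spcZ)
    show "AE x in measure_pmf (spc Z (src G f)). arr Z (compose G g f) x = arr Z g (arr Z f x)"
      if "f \<in> Mor G" "g \<in> Mor G" "tgt G f = src G g" for f g
      unfolding AE_measure_pmf_iff
    proof
      fix x assume "x \<in> set_pmf (spc Z (src G f))"
      then obtain w where w: "w \<in> set_pmf r" "x = map_prod (from_initial X (src G f)) (from_initial Y (src G f)) w"
        by (auto simp: spcZ)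
      show "arr Z (compose G g f) x = arr Z g (arr Z f x)"
        using arrZ[OF _ w(1), of "compose G g f"] arrZ[OF _ w(1), of f] arrZ[OF _ w(1), of g] co[OF that] that w(2)
        by simp
    qed
  qed
  have X': "map_pmf (from_initial X i) (map_pmf fst r) = spc X i" if "i \<in> Obj G" for i
    unfolding r using spc_from_initial[OF X that] .
  have Y': "map_pmf (from_initial Y i) (map_pmf snd r) = spc Y i" if "i \<in> Obj G" for i
    unfolding r using spc_from_initial[OF Y that] .
  have mX: "map_pmf fst (spc Z i) = spc X i" and mY: "map_pmf snd (spc Z i) = spc Y i" if "i \<in> Obj G" for i
    using X'[OF that] Y'[OF that] by (simp_all add: spcZ pmf.map_comp o_def)
  have "is_fan G X Z Y (\<lambda>_. fst) (\<lambda>_. snd)"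
    unfolding is_fan_def is_diagram_reduction_def is_reduction_def
    using dia mX mY by (auto simp: Z_def)
  then have "entropy_dist G X Y \<le> kd G X Z Y" by (rule entropy_dist_le_kd[OF cat])
  also have "kd G X Z Y = (\<Sum>i\<in>Obj G. obs_cost (from_initial X i) (from_initial Y i) r)"
    unfolding kd_def sum.distrib[symmetric]
  proof (rule sum.cong[OF refl])
    fix i assume i: "i \<in> Obj G"
    have "finite (set_pmf (spc Z i))" by (simp add: spcZ finr)
    then have "shannon_entropy (spc X i) \<le> shannon_entropy (spc Z i)" "shannon_entropy (spc Y i) \<le> shannon_entropy (spc Z i)"
      using entropy_map_le[of "spc Z i" fst] entropy_map_le[of "spc Z i" snd] mX[OF i] mY[OF i] by auto
    then show "\<bar>shannon_entropy (spc Z i) - shannon_entropy (spc X i)\<bar> + \<bar>shannon_entropy (spc Z i) - shannon_entropy (spc Y i)\<bar>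
       = obs_cost (from_initial X i) (from_initial Y i) r"
      unfolding obs_cost_def X'[OF i] Y'[OF i] spcZ by simp
  qed
  finally show ?thesis using r(3) by simp
qed

text \<open>The converse passage. The apex at the initial object is pushed to the pair of initial
  spaces; by naturality the joint observation at \<open>i\<close> is a function of the apex at
  \<open>i\<close>, so replacing the fan by this coupling does not raise the cost.\<close>

lemma fan_coupling:
  assumes X: "is_diagram G X" and Y: "is_diagram G Y" and fan: "is_fan G X Z Y \<phi> \<psi>"
  obtains r where "map_pmf fst r = spc X init_obj" "map_pmf snd r = spc Y init_obj"
    "(\<Sum>i\<in>Obj G. obs_cost (from_initial X i) (from_initial Y i) r) \<le> kd G X Z Y"
proof -
  have Z: "is_diagram G Z" and \<phi>: "is_diagram_reduction G \<phi> Z X" and \<psi>: "is_diagram_reduction G \<psi> Z Y"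
    using fan by (auto simp: is_fan_def)
  let ?r = "map_pmf (\<lambda>x. (\<phi> init_obj x, \<psi> init_obj x)) (spc Z init_obj)"
  have finZ: "finite (set_pmf (spc Z init_obj))" using Z init_obj by (simp add: finite_spc)
  have 1: "map_pmf fst ?r = spc X init_obj" "map_pmf snd ?r = spc Y init_obj"
    using \<phi> \<psi> init_obj by (auto simp: pmf.map_comp o_def is_diagram_reduction_def is_reduction_def)
  have "(\<Sum>i\<in>Obj G. obs_cost (from_initial X i) (from_initial Y i) ?r) \<le> kd G X Z Y"
    unfolding kd_def sum.distrib[symmetric]
  proof (rule sum_mono)
    fix i assume i: "i \<in> Obj G"
    have nX: "from_initial X i (\<phi> init_obj x) = \<phi> i (from_initial Z i x)" if "x \<in> set_pmf (spc Z init_obj)" for x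
      using is_diagram_reduction_natural[OF \<phi> the_mor_props(1)[OF i], of x] that
      by (simp add: the_mor_props[OF i] from_initial_def)
    have nY: "from_initial Y i (\<psi> init_obj x) = \<psi> i (from_initial Z i x)" if "x \<in> set_pmf (spc Z init_obj)" for x
      using is_diagram_reduction_natural[OF \<psi> the_mor_props(1)[OF i], of x] that
      by (simp add: the_mor_props[OF i] from_initial_def)
    have "shannon_entropy (map_pmf (map_prod (from_initial X i) (from_initial Y i)) ?r)
       \<le> shannon_entropy (map_pmf (from_initial Z i) (spc Z init_obj))"
      unfolding pmf.map_comp
      by (rule entropy_map_factor[where e = "\<lambda>y. (\<phi> i y, \<psi> i y)"]) (use finZ nX nY in auto)
    then show "obs_cost (from_initial X i) (from_initial Y i) ?r
       \<le> \<bar>shannon_entropy (spc Z i) - shannon_entropy (spc X i)\<bar> + \<bar>shannon_entropy (spc Z i) - shannon_entropy (spc Y i)\<bar>"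
      unfolding obs_cost_def 1 spc_from_initial[OF Z i] spc_from_initial[OF X i] spc_from_initial[OF Y i]
      by linarith
  qed
  with 1 show thesis by (rule that)
qed

text \<open>The inequality is strict because the infimum may fail to be attained.\<close>

lemma entropy_dist_less_coupled:
  assumes X: "is_diagram G X" and Y: "is_diagram G Y" and less: "entropy_dist G X Y < c"
  shows "coupled (Obj G) (spc X init_obj) (from_initial X) (spc Y init_obj) (from_initial Y) c"
proof -
  let ?S = "{kd G X Z Y | (Z :: ('o, 'm, nat) diagram) \<phi> \<psi>. is_fan G X Z Y \<phi> \<psi>}"
  have "?S \<noteq> {}" using ex_nat_fan[OF cat X Y] by blast
  then obtain Z :: "('o, 'm, nat) diagram" and \<phi> \<psi> where Z: "is_fan G X Z Y \<phi> \<psi>" "kd G X Z Y < c"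
    using less cInf_lessD[of ?S c] unfolding entropy_dist_def by blast
  show ?thesis
    by (rule fan_coupling[OF X Y Z(1)]) (use Z(2) in \<open>auto intro!: coupledI\<close>)
qed

section \<open>Conditioning on an atom, seen on the initial space\<close>

definition cond_initial :: "('o, 'm, 's) diagram \<Rightarrow> 's \<Rightarrow> 's pmf" where
  "cond_initial X u = cond_pmf (spc X init_obj) (from_initial X \<iota> -` {u})"

lemma set_cond_initial:
  assumes "is_diagram G X" "u \<in> set_pmf (spc X \<iota>)"
  shows "set_pmf (cond_initial X u) = set_pmf (spc X init_obj) \<inter> from_initial X \<iota> -` {u}"
  unfolding cond_initial_def
proof (rule set_cond_pmf)
  show "set_pmf (spc X init_obj) \<inter> from_initial X \<iota> -` {u} \<noteq> {}"
    using assms(2) unfolding spc_from_initial[OF assms(1) \<iota>, symmetric] by auto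
qed

lemma finite_cond_initial:
  assumes "is_diagram G X" "u \<in> set_pmf (spc X \<iota>)"
  shows "finite (set_pmf (cond_initial X u))"
  using finite_spc[OF assms(1) init_obj] unfolding set_cond_initial[OF assms] by simp

lemma spc_cond_diagram: "spc (cond_diagram G X \<iota> u) i = map_pmf (from_initial X i) (cond_initial X u)"
  by (simp add: cond_diagram_def Let_def from_initial_def cond_initial_def init_obj_def)

lemma arr_cond_diagram: "arr (cond_diagram G X \<iota> u) = arr X"
  by (simp add: cond_diagram_def Let_def)

lemma spc_cond_diagram_init_obj:
  assumes "is_diagram G X" "u \<in> set_pmf (spc X \<iota>)"
  shows "spc (cond_diagram G X \<iota> u) init_obj = cond_initial X u"
proof -
  have "map_pmf (from_initial X init_obj) (cond_initial X u) = map_pmf (\<lambda>x. x) (cond_initial X u)"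
    by (rule map_pmf_cong[OF refl]) (use assms in \<open>simp add: set_cond_initial from_initial_init_obj\<close>)
  then show ?thesis by (simp add: spc_cond_diagram)
qed

lemma is_diagram_cond:
  assumes X: "is_diagram G X" and u: "u \<in> set_pmf (spc X \<iota>)"
  shows "is_diagram G (cond_diagram G X \<iota> u)"
  unfolding is_diagram_def is_reduction_def spc_cond_diagram arr_cond_diagram
proof (intro conjI ballI impI)
  note s = set_cond_initial[OF assms]
  show "finite (set_pmf (map_pmf (from_initial X i) (cond_initial X u)))" for i
    using finite_cond_initial[OF assms] by simp
  show "map_pmf (arr X f) (map_pmf (from_initial X (src G f)) (cond_initial X u)) = map_pmf (from_initial X (tgt G f)) (cond_initial X u)"
    if "f \<in> Mor G" for f
    unfolding pmf.map_comp by (rule map_pmf_cong[OF refl]) (use that from_initial_arr[OF X] s in auto)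
  show "AE x in measure_pmf (map_pmf (from_initial X i) (cond_initial X u)). arr X (ident G i) x = x" if i: "i \<in> Obj G" for i
    using X i from_initial_mem[OF X i] s by (auto simp: AE_measure_pmf_iff is_diagram_def)
  show "AE x in measure_pmf (map_pmf (from_initial X (src G f)) (cond_initial X u)).
      arr X (compose G g f) x = arr X g (arr X f x)"
    if "f \<in> Mor G" "g \<in> Mor G" "tgt G f = src G g" for f g
  proof -
    have "src G f \<in> Obj G" using that cat by (auto simp: is_category_def)
    then show ?thesis
      using X that from_initial_mem[OF X] s by (auto simp: AE_measure_pmf_iff is_diagram_def)
  qed
qed

lemma is_diagram_tropical_cond:
  assumes X: "is_diagram G X"
  shows "is_diagram G (tropical_cond G X \<iota> n)"
  unfolding tropical_cond_def tensor_power_def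
  by (intro is_diagram_tensor cat finite_spc[OF X \<iota>] is_diagram_cond[OF X]) auto

lemma spc_tropical_cond_init_obj:
  assumes X: "is_diagram G X"
  shows "spc (tropical_cond G X \<iota> n) init_obj = Pi_pmf (set_pmf (spc X \<iota>)) undefined
    (\<lambda>u. Pi_pmf {..<nat \<lfloor>real n * pmf (spc X \<iota>) u\<rfloor>} undefined (\<lambda>j. cond_initial X u))"
  unfolding tropical_cond_def tensor_power_def
  by (auto simp: tensor_def spc_cond_diagram_init_obj[OF X] intro!: Pi_pmf_cong)

lemma from_initial_tropical_cond:
  "from_initial (tropical_cond G X \<iota> n) =
    nested_obs (from_initial X) (set_pmf (spc X \<iota>)) (\<lambda>u. {..<nat \<lfloor>real n * pmf (spc X \<iota>) u\<rfloor>})"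
  unfolding tropical_cond_def tensor_power_def from_initial_def nested_obs_def
  by (auto simp: tensor_def arr_cond_diagram fun_eq_iff)

text \<open>Passage from the diagrams of the statement to flat families of independent factors,
  where matching and averaging take place. Each side is flattened separately by
  \<open>coupled_nested_iff\<close>.\<close>

lemma coupled_tropical_cond_iff:
  assumes X: "is_diagram G X" and Y: "is_diagram G Y"
  shows "coupled (Obj G) (spc (tropical_cond G X \<iota> n) init_obj) (from_initial (tropical_cond G X \<iota> n))
      (spc (tropical_cond G Y \<iota> n) init_obj) (from_initial (tropical_cond G Y \<iota> n)) c \<longleftrightarrow>
    coupled_products (Obj G) (from_initial X) (from_initial Y)
      (quota_sites (spc X \<iota>) n) (\<lambda>s. cond_initial X (fst s)) (quota_sites (spc Y \<iota>) n) (\<lambda>s. cond_initial Y (fst s)) c"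
proof -
  have 1: "coupled (Obj G) (spc (tropical_cond G X \<iota> n) init_obj) (from_initial (tropical_cond G X \<iota> n)) q g c \<longleftrightarrow>
     coupled (Obj G) (Pi_pmf (quota_sites (spc X \<iota>) n) undefined (\<lambda>s. cond_initial X (fst s))) (product_obs (from_initial X) (quota_sites (spc X \<iota>) n)) q g c"
    if X: "is_diagram G X" and q: "finite (set_pmf q)" for X :: "('o, 'm, 'u) diagram" and q :: "'v pmf" and g :: "'o \<Rightarrow> 'v \<Rightarrow> 'w" and c
    unfolding spc_tropical_cond_init_obj[OF X] from_initial_tropical_cond quota_sites_def
    using coupled_nested_iff[of "set_pmf (spc X \<iota>)" "\<lambda>u. {..<nat \<lfloor>real n * pmf (spc X \<iota>) u\<rfloor>}"
        "\<lambda>s. cond_initial X (fst s)" q "Obj G" "from_initial X" g c]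
      finite_spc[OF X \<iota>] finite_cond_initial[OF X] q
    by auto
  have fX: "finite (set_pmf (Pi_pmf (quota_sites (spc X \<iota>) n) undefined (\<lambda>s. cond_initial X (fst s))))"
    by (intro finite_set_Pi_pmf finite_quota_sites finite_spc[OF X \<iota>] finite_cond_initial[OF X] fst_quota_sites)
  have fY: "finite (set_pmf (spc (tropical_cond G Y \<iota> n) init_obj))"
    using is_diagram_tropical_cond[OF Y] init_obj by (rule finite_spc)
  show ?thesis
    unfolding coupled_products_def 1[OF X fY] by (subst (1 2) coupled_sym_iff) (rule 1[OF Y fX])
qed

end

section \<open>Conditioning and concentration\<close>

lemma cond_pmf_cond_pmf:
  assumes "A \<subseteq> B" "set_pmf p \<inter> A \<noteq> {}"
  shows "cond_pmf (cond_pmf p B) A = cond_pmf p A"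
proof (rule pmf_eqI)
  fix x
  have B: "set_pmf p \<inter> B \<noteq> {}" using assms by auto
  have BA: "set_pmf (cond_pmf p B) \<inter> A \<noteq> {}" using assms B by auto
  have pB: "measure p B > 0" using B by (auto intro: measure_pmf_posI)
  have "measure (cond_pmf p B) A = measure p A / measure p B"
    unfolding cond_pmf.rep_eq[OF B]
    using pB assms(1) by (subst measure_uniform_measure) (auto simp: Int_absorb1 measure_pmf.emeasure_eq_measure)
  then show "pmf (cond_pmf (cond_pmf p B) A) x = pmf (cond_pmf p A) x"
    using assms(1) pB by (auto simp: pmf_cond[OF BA] pmf_cond[OF B] pmf_cond[OF assms(2)])
qed

lemma measure_vimage_singleton: "measure (measure_pmf p) (h -` {y}) = pmf (map_pmf h p) y"
  by (simp add: pmf_map)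

text \<open>Total probability over the fibres of \<open>h\<close>, relative to an event that is a
  union of fibres. With \<open>h\<close> the class map this exhibits \<open>X|u\<close> as the
  mixture of the \<open>X|c\<close> over the classes \<open>c\<close> extending
  \<open>u\<close>.\<close>

lemma cond_pmf_vimage:
  assumes ne: "set_pmf p \<inter> h -` B \<noteq> {}"
  shows "cond_pmf p (h -` B) = bind_pmf (cond_pmf (map_pmf h p) B) (\<lambda>y. cond_pmf p (h -` {y}))"
proof -
  let ?q = "cond_pmf p (h -` B)"
  have hq: "cond_pmf (map_pmf h p) B = map_pmf h ?q" by (rule cond_map_pmf[OF ne])
  have "bind_pmf (map_pmf h ?q) (\<lambda>x. cond_pmf ?q {y. h y = x}) = ?q"
  proof (rule bind_cond_pmf_cancel)
    show "set_pmf ?q \<inter> {y. h y = x} \<noteq> {}" if "x \<in> set_pmf (map_pmf h ?q)" for x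
      using that by auto
    show "set_pmf (map_pmf h ?q) \<inter> {x. h y = x} \<noteq> {}" if "y \<in> set_pmf ?q" for y
      using that by auto
    show "measure ?q {y. h y = x} = measure (map_pmf h ?q) {x. h y = x}" if "h y = x" for x y
    proof -
      have "{x. h y = x} = {x}" "{y. h y = x} = h -` {x}" using that by auto
      then show ?thesis by (simp only: measure_vimage_singleton) (simp add: measure_pmf_single)
    qed
  qed
  \<comment> \<open>Each fibre that occurs lies inside the event, so conditioning on the event
    beforehand makes no difference.\<close>
  moreover have "bind_pmf (map_pmf h ?q) (\<lambda>x. cond_pmf ?q {y. h y = x})
     = bind_pmf (map_pmf h ?q) (\<lambda>y. cond_pmf p (h -` {y}))"
  proof (rule bind_pmf_cong[OF refl])
    fix x assume x: "x \<in> set_pmf (map_pmf h ?q)"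
    have e: "{y. h y = x} = h -` {x}" by auto
    show "cond_pmf ?q {y. h y = x} = cond_pmf p (h -` {x})"
      unfolding e using x ne by (intro cond_pmf_cond_pmf) auto
  qed
  ultimately show ?thesis by (simp add: hq)
qed

lemma bind_cond_pmf_vimage: "bind_pmf (map_pmf h p) (\<lambda>y. cond_pmf p (h -` {y})) = p"
proof -
  have u: "cond_pmf q UNIV = q" for q :: "'x pmf"
    by (rule pmf_eqI) (subst pmf_cond, simp_all add: set_pmf_not_empty)
  have "set_pmf p \<inter> h -` UNIV \<noteq> {}" by (simp add: set_pmf_not_empty)
  from cond_pmf_vimage[OF this] show ?thesis by (simp add: u)
qed

text \<open>The expectation on the right is the conditional entropy H(A|h); the chain rule applies
  after splitting \<open>p\<close> into the fibres of \<open>h\<close>.\<close>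

lemma entropy_conditional:
  assumes fin: "finite (set_pmf p)"
  shows "shannon_entropy (map_pmf (\<lambda>x. (h x, A x)) p) = shannon_entropy (map_pmf h p)
    + expect (map_pmf h p) (\<lambda>y. shannon_entropy (map_pmf A (cond_pmf p (h -` {y}))))"
proof -
  let ?c = "\<lambda>y. cond_pmf p (h -` {y})"
  have sc: "set_pmf (?c y) = set_pmf p \<inter> h -` {y}" if "y \<in> set_pmf (map_pmf h p)" for y
    using that by (subst set_cond_pmf) auto
  have "map_pmf (\<lambda>x. (h x, A x)) p = bind_pmf (map_pmf h p) (\<lambda>y. map_pmf (\<lambda>x. (h x, A x)) (?c y))"
    by (subst bind_cond_pmf_vimage[of h p, symmetric]) (simp only: map_bind_pmf)
  also have "\<dots> = bind_pmf (map_pmf h p) (\<lambda>y. map_pmf (Pair y) (map_pmf A (?c y)))"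
    by (rule bind_pmf_cong[OF refl], unfold pmf.map_comp, rule map_pmf_cong[OF refl]) (simp add: sc)
  also have "shannon_entropy \<dots> = shannon_entropy (map_pmf h p)
    + expect (map_pmf h p) (\<lambda>y. shannon_entropy (map_pmf A (?c y)))"
    by (rule entropy_chain) (use fin sc in auto)
  finally show ?thesis .
qed

lemma entropy_conditional_id:
  assumes fin: "finite (set_pmf p)"
  shows "expect (map_pmf h p) (\<lambda>y. shannon_entropy (cond_pmf p (h -` {y})))
     = shannon_entropy p - shannon_entropy (map_pmf h p)"
proof -
  have "shannon_entropy (map_pmf (\<lambda>x. (h x, x)) p) = shannon_entropy p"
    by (rule shannon_entropy_map_inj) (auto simp: inj_on_def)
  then show ?thesis using entropy_conditional[OF fin, of h "\<lambda>x. x"] by simp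
qed

text \<open>As \<open>B\<close> is a function of \<open>A\<close>, the right side is H(A|B) and the
  left side is H(A|B,h). Further conditioning cannot raise entropy, which is submodularity with
  \<open>B\<close> in the middle.\<close>

lemma conditional_gap_le:
  assumes fin: "finite (set_pmf p)" and e: "\<And>x. B x = e (A x)"
  shows "expect (map_pmf h p) (\<lambda>y. shannon_entropy (map_pmf A (cond_pmf p (h -` {y}))))
     - expect (map_pmf h p) (\<lambda>y. shannon_entropy (map_pmf B (cond_pmf p (h -` {y}))))
    \<le> shannon_entropy (map_pmf A p) - shannon_entropy (map_pmf B p)"
proof -
  have "shannon_entropy (map_pmf (\<lambda>x. (h x, A x)) p) \<le> shannon_entropy (map_pmf (\<lambda>x. (A x, B x, h x)) p)"
    by (rule entropy_map_factor[OF fin, where e = "\<lambda>(a, b, c). (c, a)"]) simp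
  moreover have "shannon_entropy (map_pmf (\<lambda>x. (A x, B x)) p) \<le> shannon_entropy (map_pmf A p)"
    by (rule entropy_map_factor[OF fin, where e = "\<lambda>a. (a, e a)"]) (simp add: e)
  moreover have "shannon_entropy (map_pmf (\<lambda>x. (B x, h x)) p) \<le> shannon_entropy (map_pmf (\<lambda>x. (h x, B x)) p)"
    by (rule entropy_map_factor[OF fin, where e = prod.swap]) simp
  ultimately show ?thesis
    using entropy_submodular[OF fin, of A B h] entropy_conditional[OF fin, of h A]
      entropy_conditional[OF fin, of h B] by linarith
qed

text \<open>The cost is the sum of two gaps, joint minus left and joint minus right. In each of them
  the smaller observation is a function of the joint one, so \<open>conditional_gap_le\<close>
  applies to both.\<close>

lemma obs_cost_cond_le:
  assumes fin: "finite (set_pmf r)"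
  shows "expect (map_pmf h r) (\<lambda>c. obs_cost f g (cond_pmf r (h -` {c}))) \<le> obs_cost f g r"
proof -
  let ?E = "\<lambda>A. expect (map_pmf h r) (\<lambda>y. shannon_entropy (map_pmf A (cond_pmf r (h -` {y}))))"
  have fh: "finite (set_pmf (map_pmf h r))" using fin by simp
  have "expect (map_pmf h r) (\<lambda>c. obs_cost f g (cond_pmf r (h -` {c})))
     = 2 * ?E (map_prod f g) - ?E (f \<circ> fst) - ?E (g \<circ> snd)"
    unfolding obs_cost_def pmf.map_comp by (subst expect_diff[OF fh])+ (simp only: integral_mult_right_zero)
  moreover have "?E (map_prod f g) - ?E (f \<circ> fst) \<le> shannon_entropy (map_pmf (map_prod f g) r) - shannon_entropy (map_pmf (f \<circ> fst) r)"
    by (rule conditional_gap_le[OF fin, where e = fst]) simp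
  moreover have "?E (map_prod f g) - ?E (g \<circ> snd) \<le> shannon_entropy (map_pmf (map_prod f g) r) - shannon_entropy (map_pmf (g \<circ> snd) r)"
    by (rule conditional_gap_le[OF fin, where e = snd]) simp
  ultimately show ?thesis unfolding obs_cost_def pmf.map_comp by linarith
qed

lemma entropy_Pi_pmf_le:
  assumes "finite S" "\<And>s. s \<in> S \<Longrightarrow> finite (set_pmf (D s))"
  shows "shannon_entropy (Pi_pmf S d D) \<le> (\<Sum>s\<in>S. shannon_entropy (D s))"
  using assms
proof (induction S)
  case (insert s S)
  have fin: "finite (set_pmf (D s))" "finite (set_pmf (Pi_pmf S d D))"
    using insert by (auto intro!: finite_set_Pi_pmf)
  have "shannon_entropy (Pi_pmf (insert s S) d D) \<le> shannon_entropy (pair_pmf (D s) (Pi_pmf S d D))"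
    unfolding Pi_pmf_insert[OF insert.hyps] by (rule entropy_map_le) (use fin in auto)
  also have "\<dots> = shannon_entropy (D s) + shannon_entropy (Pi_pmf S d D)"
    by (rule entropy_pair) fact+
  finally show ?case using insert by fastforce
qed simp

section \<open>Fluctuations of class counts\<close>

lemma expect_pair:
  fixes g :: "'a \<times> 'b \<Rightarrow> real"
  assumes "finite (set_pmf p)" "finite (set_pmf q)"
  shows "expect (pair_pmf p q) g = expect p (\<lambda>x. expect q (\<lambda>y. g (x, y)))"
proof -
  have "pair_pmf p q = bind_pmf p (\<lambda>x. map_pmf (Pair x) q)"
    by (simp add: pair_pmf_def map_pmf_def)
  then show ?thesis using assms by (simp add: expect_bind)
qed

definition centred_count :: "'k set \<Rightarrow> ('k \<Rightarrow> 'c pmf) \<Rightarrow> 'c \<Rightarrow> ('k \<Rightarrow> 'c) \<Rightarrow> real" where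
  "centred_count S \<mu> c w = real (card {s \<in> S. w s = c}) - (\<Sum>s\<in>S. pmf (\<mu> s) c)"

text \<open>The count is a sum of independent indicators. Centred, each is bounded by 1 in absolute
  value, so the variances add up to at most the number of sites.\<close>

lemma centred_count_moments:
  assumes "finite S" "\<And>s. s \<in> S \<Longrightarrow> finite (set_pmf (\<mu> s))"
  shows "expect (Pi_pmf S d \<mu>) (centred_count S \<mu> c) = 0 \<and>
    expect (Pi_pmf S d \<mu>) (\<lambda>w. (centred_count S \<mu> c w)\<^sup>2) \<le> real (card S)"
  using assms
proof (induction S)
  case empty
  then show ?case by (simp add: centred_count_def)
next
  case (insert s S)
  let ?P = "Pi_pmf S d \<mu>"
  let ?\<delta> = "\<lambda>y. indicator {c} y - pmf (\<mu> s) c :: real"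
  let ?Y = "centred_count S \<mu> c"
  have fs: "finite (set_pmf (\<mu> s))" and fP: "finite (set_pmf ?P)"
    using insert by (auto intro!: finite_set_Pi_pmf)
  have IH: "expect ?P ?Y = 0" "expect ?P (\<lambda>w. (?Y w)\<^sup>2) \<le> real (card S)"
    using insert by auto
  have upd: "centred_count (insert s S) \<mu> c (f(s := y)) = ?\<delta> y + ?Y f" for y f
  proof -
    have e: "{t \<in> S. (f(s := y)) t = c} = {t \<in> S. f t = c}" using insert.hyps by auto
    have "card {t \<in> insert s S. (f(s := y)) t = c} = card {t \<in> S. f t = c} + (if c = y then 1 else 0)"
      unfolding card_Collect_insert[OF insert.hyps] e by simp
    then show ?thesis using insert.hyps by (auto simp: centred_count_def indicator_def)
  qed
  have E: "expect (Pi_pmf (insert s S) d \<mu>) g = expect (\<mu> s) (\<lambda>y. expect ?P (\<lambda>f. g (f(s := y))))" for g :: "_ \<Rightarrow> real"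
    unfolding Pi_pmf_insert[OF insert.hyps] by (simp add: expect_pair fs fP split_beta)
  have E\<delta>: "expect (\<mu> s) ?\<delta> = 0"
    by (simp add: expect_diff[OF fs] measure_pmf_single)
  have "expect (Pi_pmf (insert s S) d \<mu>) (centred_count (insert s S) \<mu> c) = 0"
    unfolding E upd by (simp add: expect_add[OF fP] IH E\<delta>)
  moreover have "expect (Pi_pmf (insert s S) d \<mu>) (\<lambda>w. (centred_count (insert s S) \<mu> c w)\<^sup>2) \<le> real (card (insert s S))"
  proof -
    \<comment> \<open>The mixed term vanishes because \<open>?Y\<close> has mean zero.\<close>
    have "expect ?P (\<lambda>f. (?\<delta> y + ?Y f)\<^sup>2) = (?\<delta> y)\<^sup>2 + expect ?P (\<lambda>w. (?Y w)\<^sup>2)" for y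
    proof -
      have "(\<lambda>f. (?\<delta> y + ?Y f)\<^sup>2) = (\<lambda>f. ((?\<delta> y)\<^sup>2 + 2 * ?\<delta> y * ?Y f) + (?Y f)\<^sup>2)"
        by (simp add: power2_eq_square algebra_simps)
      then have "expect ?P (\<lambda>f. (?\<delta> y + ?Y f)\<^sup>2) = expect ?P (\<lambda>f. ((?\<delta> y)\<^sup>2 + 2 * ?\<delta> y * ?Y f) + (?Y f)\<^sup>2)"
        by (rule arg_cong)
      also have "\<dots> = (?\<delta> y)\<^sup>2 + 2 * ?\<delta> y * expect ?P ?Y + expect ?P (\<lambda>w. (?Y w)\<^sup>2)"
        by (subst expect_add[OF fP])+ simp
      finally show ?thesis by (simp add: IH)
    qed
    then have "expect (Pi_pmf (insert s S) d \<mu>) (\<lambda>w. (centred_count (insert s S) \<mu> c w)\<^sup>2)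
       = expect (\<mu> s) (\<lambda>y. (?\<delta> y)\<^sup>2) + expect ?P (\<lambda>w. (?Y w)\<^sup>2)"
      unfolding E upd by (simp add: expect_add[OF fs])
    also have "expect (\<mu> s) (\<lambda>y. (?\<delta> y)\<^sup>2) \<le> expect (\<mu> s) (\<lambda>y. 1)"
    proof (rule expect_mono[OF fs])
      fix y
      have "\<bar>?\<delta> y\<bar> \<le> 1" using pmf_le_1[of "\<mu> s" c] by (auto simp: indicator_def abs_le_iff intro: order_trans[OF _ pmf_nonneg])
      then show "(?\<delta> y)\<^sup>2 \<le> 1" by (simp add: abs_square_le_1)
    qed
    finally show ?thesis using IH(2) insert.hyps by simp
  qed
  ultimately show ?case by blast
qed

text \<open>The variance of the absolute value of \<open>Y\<close> is nonnegative.\<close>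

lemma expect_abs_le_sqrt:
  assumes fin: "finite (set_pmf p)" and b: "expect p (\<lambda>x. (Y x)\<^sup>2) \<le> b"
  shows "expect p (\<lambda>x. \<bar>Y x\<bar>) \<le> sqrt b"
proof -
  let ?m = "expect p (\<lambda>x. \<bar>Y x\<bar>)"
  have "0 \<le> expect p (\<lambda>x. (\<bar>Y x\<bar> - ?m)\<^sup>2)" by (rule expect_nonneg[OF fin]) simp
  also have "(\<lambda>x. (\<bar>Y x\<bar> - ?m)\<^sup>2) = (\<lambda>x. ((Y x)\<^sup>2 - 2 * ?m * \<bar>Y x\<bar>) + ?m\<^sup>2)"
    by (rule ext) (simp add: power2_diff)
  also have "expect p \<dots> = expect p (\<lambda>x. (Y x)\<^sup>2) - ?m\<^sup>2"
    by (subst expect_add[OF fin], subst expect_diff[OF fin]) (simp add: power2_eq_square)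
  finally have "?m\<^sup>2 \<le> b" using b by linarith
  then show ?thesis by (rule real_le_rsqrt)
qed

text \<open>The deviation is measured from a target \<open>t\<close> near the mean, not from the
  mean itself: rounding gives the counts on the two sides slightly different means, and they must be
  compared with one common value.\<close>

lemma expect_count_deviation:
  assumes fin: "finite S" "\<And>s. s \<in> S \<Longrightarrow> finite (set_pmf (\<mu> s))"
    and t: "\<bar>(\<Sum>s\<in>S. pmf (\<mu> s) c) - t\<bar> \<le> \<epsilon>"
  shows "expect (Pi_pmf S d \<mu>) (\<lambda>w. \<bar>real (card {s \<in> S. w s = c}) - t\<bar>) \<le> sqrt (real (card S)) + \<epsilon>"
proof -
  let ?P = "Pi_pmf S d \<mu>"
  have fP: "finite (set_pmf ?P)" using fin by (intro finite_set_Pi_pmf) auto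
  have "expect ?P (\<lambda>w. \<bar>real (card {s \<in> S. w s = c}) - t\<bar>) \<le> expect ?P (\<lambda>w. \<bar>centred_count S \<mu> c w\<bar> + \<epsilon>)"
    by (rule expect_mono[OF fP]) (use t in \<open>simp add: centred_count_def\<close>)
  also have "\<dots> = expect ?P (\<lambda>w. \<bar>centred_count S \<mu> c w\<bar>) + \<epsilon>"
    by (simp add: expect_add[OF fP])
  also have "\<dots> \<le> sqrt (real (card S)) + \<epsilon>"
    using centred_count_moments[where S = S and \<mu> = \<mu> and d = d and c = c, OF fin] by (intro add_right_mono expect_abs_le_sqrt[OF fP]) auto
  finally show ?thesis .
qed

lemma expect_count:
  assumes fin: "finite S" "\<And>s. s \<in> S \<Longrightarrow> finite (set_pmf (\<mu> s))"
  shows "expect (Pi_pmf S d \<mu>) (\<lambda>w. real (card {s \<in> S. w s = c})) = (\<Sum>s\<in>S. pmf (\<mu> s) c)"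
proof -
  have fP: "finite (set_pmf (Pi_pmf S d \<mu>))" using fin by (intro finite_set_Pi_pmf) auto
  have "expect (Pi_pmf S d \<mu>) (centred_count S \<mu> c) = 0"
    using centred_count_moments[where S = S and \<mu> = \<mu> and d = d and c = c, OF fin] by blast
  then show ?thesis unfolding centred_count_def by (simp add: expect_diff[OF fP])
qed

text \<open>Fekete's lemma. Adding the constant \<open>C\<close> to the sequence makes it exactly
  subadditive, and \<open>C / n\<close> disappears in the limit.\<close>

lemma subadditive_convergent:
  fixes a :: "nat \<Rightarrow> real"
  assumes nonneg: "\<And>n. 0 \<le> a n" and sub: "\<And>m n. a (m + n) \<le> a m + a n + C" and C: "0 \<le> C"
  shows "convergent (\<lambda>n. 1 / real n * a n)"
proof -
  define b where "b n = a n + C" for n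
  have b0: "0 \<le> b n" for n using nonneg C by (simp add: b_def)
  have bsub: "b (m + n) \<le> b m + b n" for m n using sub[of m n] by (simp add: b_def)
  define L where "L = (INF n\<in>{1..}. b n / real n)"
  have bdd: "bdd_below ((\<lambda>n. b n / real n) ` {1..})"
    by (rule bdd_belowI[of _ 0]) (use b0 in auto)
  have L_le: "L \<le> b n / real n" if "n \<ge> 1" for n
    unfolding L_def by (rule cINF_lower[OF bdd]) (use that in auto)
  have mult: "b (q * N + r) \<le> real q * b N + b r" for q N r
  proof (induction q)
    case (Suc q)
    have "b (Suc q * N + r) \<le> b N + b (q * N + r)" using bsub[of N "q * N + r"] by (simp add: add.assoc)
    then show ?case using Suc by (simp add: algebra_simps)
  qed simp
  have "(\<lambda>n. b n / real n) \<longlonglongrightarrow> L"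
  proof (rule LIMSEQ_I)
    fix \<epsilon> :: real assume \<epsilon>: "0 < \<epsilon>"
    have "\<exists>N\<in>{1..}. b N / real N < L + \<epsilon> / 2"
      using cINF_less_iff[OF _ bdd, of "L + \<epsilon> / 2"] \<epsilon> unfolding L_def[symmetric] by auto
    then obtain N where N: "N \<ge> 1" "b N / real N < L + \<epsilon> / 2" by auto
    define M where "M = (\<Sum>r<N. b r)"
    have M: "b r \<le> M" if "r < N" for r
      unfolding M_def by (rule member_le_sum) (use that b0 in auto)
    have ub: "b n / real n \<le> b N / real N + M / real n" if "n \<ge> 1" for n
    proof -
      \<comment> \<open>Division with remainder by \<open>N\<close>, whose quotient
        \<open>b N / N\<close> is close to the infimum. The remainder contributes at most
        \<open>M\<close>, independently of \<open>n\<close>.\<close>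
      have "b n \<le> real (n div N) * b N + b (n mod N)"
        using mult[of "n div N" N "n mod N"] by simp
      also have "\<dots> \<le> real n / real N * b N + M"
      proof (intro add_mono mult_right_mono b0 M)
        show "real (n div N) \<le> real n / real N" by (rule of_nat_div_le_of_nat)
      qed (use N in auto)
      finally show ?thesis using that N by (simp add: field_simps)
    qed
    obtain n0 where n0: "n0 \<ge> 1" "M / real n0 < \<epsilon> / 2"
    proof -
      obtain k :: nat where "M / (\<epsilon> / 2) < real k" using reals_Archimedean2 by blast
      then have "M / (\<epsilon> / 2) < real (Suc k)" by simp
      then have "M / real (Suc k) < \<epsilon> / 2" using \<epsilon> by (simp add: field_simps)
      then show ?thesis using that[of "Suc k"] by simp
    qed
    have M0: "0 \<le> M" unfolding M_def by (intro sum_nonneg b0)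
    show "\<exists>n0. \<forall>n\<ge>n0. norm (b n / real n - L) < \<epsilon>"
    proof (intro exI[of _ n0] allI impI)
      fix n assume n: "n \<ge> n0"
      have "M / real n \<le> M / real n0" using n n0 M0 by (intro divide_left_mono) auto
      moreover have "b n / real n \<le> b N / real N + M / real n" "L \<le> b n / real n"
        using ub[of n] L_le[of n] n n0(1) by auto
      ultimately have "\<bar>b n / real n - L\<bar> < \<epsilon>" using n0(2) N(2) by linarith
      then show "norm (b n / real n - L) < \<epsilon>" by simp
    qed
  qed
  moreover have "(\<lambda>n. C / real n) \<longlonglongrightarrow> 0" by (rule lim_const_over_n)
  ultimately have "(\<lambda>n. b n / real n - C / real n) \<longlonglongrightarrow> L - 0" by (rule tendsto_diff)
  then show ?thesis unfolding b_def convergent_def by (auto simp: diff_divide_distrib[symmetric])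
qed

section \<open>The cost of tropical conditioning\<close>

lemma nat_floor_bounds:
  fixes x :: real
  assumes "0 \<le> x"
  shows "real (nat \<lfloor>x\<rfloor>) \<le> x" "x - 1 \<le> real (nat \<lfloor>x\<rfloor>)"
  using assms by linarith+

lemma sum_quota_sites:
  fixes F :: "'c \<Rightarrow> real"
  assumes "finite (set_pmf p)"
  shows "(\<Sum>s\<in>quota_sites p n. F (fst s)) = (\<Sum>u\<in>set_pmf p. real (nat \<lfloor>real n * pmf p u\<rfloor>) * F u)"
proof -
  have "(\<Sum>s\<in>quota_sites p n. F (fst s)) = (\<Sum>u\<in>set_pmf p. \<Sum>j\<in>{..<nat \<lfloor>real n * pmf p u\<rfloor>}. F u)"
    unfolding quota_sites_def by (subst sum.Sigma) (auto simp: assms split_beta)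
  then show ?thesis by simp
qed

lemma sum_quota_sites_le:
  fixes F :: "'c \<Rightarrow> real"
  assumes fin: "finite (set_pmf p)" and F: "\<And>u. u \<in> set_pmf p \<Longrightarrow> 0 \<le> F u"
  shows "(\<Sum>s\<in>quota_sites p n. F (fst s)) \<le> real n * expect p F"
proof -
  have "(\<Sum>s\<in>quota_sites p n. F (fst s)) \<le> (\<Sum>u\<in>set_pmf p. real n * pmf p u * F u)"
    unfolding sum_quota_sites[OF fin] by (intro sum_mono mult_right_mono F nat_floor_bounds) auto
  then show ?thesis by (simp add: expect_finite[OF fin] sum_distrib_left mult.assoc)
qed

lemma card_quota_sites_le:
  assumes "finite (set_pmf p)"
  shows "real (card (quota_sites p n)) \<le> real n"
  using sum_quota_sites_le[OF assms, of "\<lambda>_. 1" n] by simp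

text \<open>The expected number of sites drawing the class \<open>c\<close>. Only sites over
  \<open>h c\<close> contribute, each with probability
  \<open>pmf p c / pmf (map_pmf h p) (h c)\<close>. This ratio is at most 1, so rounding the number
  of these sites down loses at most 1.\<close>

lemma sum_pmf_cond_quota:
  assumes fin: "finite (set_pmf p)" and c: "c \<in> set_pmf p"
  shows "(\<Sum>s\<in>quota_sites (map_pmf h p) n. pmf (cond_pmf p (h -` {fst s})) c) \<in> {real n * pmf p c - 1 .. real n * pmf p c}"
proof -
  let ?q = "map_pmf h p"
  have finq: "finite (set_pmf ?q)" using fin by simp
  have q: "0 < pmf ?q (h c)" "pmf p c \<le> pmf ?q (h c)"
    using c by (auto intro: pmf_positive pmf_map_ge)
  have "pmf (cond_pmf p (h -` {u})) c = (if u = h c then pmf p c / pmf ?q (h c) else 0)" if "u \<in> set_pmf ?q" for u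
  proof -
    have "set_pmf p \<inter> h -` {u} \<noteq> {}" using that by auto
    then show ?thesis by (auto simp: pmf_cond pmf_map)
  qed
  then have "(\<Sum>s\<in>quota_sites ?q n. pmf (cond_pmf p (h -` {fst s})) c)
     = (\<Sum>u\<in>set_pmf ?q. if u = h c then real (nat \<lfloor>real n * pmf ?q u\<rfloor>) * (pmf p c / pmf ?q (h c)) else 0)"
    unfolding sum_quota_sites[OF finq, where F = "\<lambda>u. pmf (cond_pmf p (h -` {u})) c"] by (intro sum.cong) auto
  also have "\<dots> = real (nat \<lfloor>real n * pmf ?q (h c)\<rfloor>) * (pmf p c / pmf ?q (h c))"
    using finq c by (subst sum.delta) auto
  finally have e: "(\<Sum>s\<in>quota_sites ?q n. pmf (cond_pmf p (h -` {fst s})) c) = real (nat \<lfloor>real n * pmf ?q (h c)\<rfloor>) * (pmf p c / pmf ?q (h c))" .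
  have b: "real (nat \<lfloor>real n * pmf ?q (h c)\<rfloor>) \<le> real n * pmf ?q (h c)"
    "real n * pmf ?q (h c) - 1 \<le> real (nat \<lfloor>real n * pmf ?q (h c)\<rfloor>)"
    by (rule nat_floor_bounds; simp)+
  have t: "0 \<le> pmf p c / pmf ?q (h c)" "pmf p c / pmf ?q (h c) \<le> 1" using q by auto
  have m: "real n * pmf ?q (h c) * (pmf p c / pmf ?q (h c)) = real n * pmf p c" using q by simp
  have "real (nat \<lfloor>real n * pmf ?q (h c)\<rfloor>) * (pmf p c / pmf ?q (h c)) \<le> real n * pmf p c"
    using mult_right_mono[OF b(1) t(1)] m by simp
  moreover have "real n * pmf p c - 1 \<le> real (nat \<lfloor>real n * pmf ?q (h c)\<rfloor>) * (pmf p c / pmf ?q (h c))"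
    using mult_right_mono[OF b(2) t(1)] m t(2) by (simp only: left_diff_distrib)
  ultimately show ?thesis unfolding e by simp
qed

text \<open>An atom \<open>u\<close> occupies at most \<open>n\<close> times its weight many sites,
  so all labels together have entropy at most \<open>n\<close> times the conditional entropy of
  \<open>p\<close> given \<open>h\<close>.\<close>

lemma entropy_cond_quota:
  assumes fin: "finite (set_pmf p)"
  shows "shannon_entropy (Pi_pmf (quota_sites (map_pmf h p) n) d (\<lambda>s. cond_pmf p (h -` {fst s})))
    \<le> real n * (shannon_entropy p - shannon_entropy (map_pmf h p))"
proof -
  have "shannon_entropy (Pi_pmf (quota_sites (map_pmf h p) n) d (\<lambda>s. cond_pmf p (h -` {fst s})))
    \<le> (\<Sum>s\<in>quota_sites (map_pmf h p) n. shannon_entropy (cond_pmf p (h -` {fst s})))"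
  proof (rule entropy_Pi_pmf_le)
    show "finite (quota_sites (map_pmf h p) n)" using fin by (simp add: finite_quota_sites)
    fix s assume "s \<in> quota_sites (map_pmf h p) n"
    from fst_quota_sites[OF this] have "set_pmf p \<inter> h -` {fst s} \<noteq> {}" by auto
    then show "finite (set_pmf (cond_pmf p (h -` {fst s})))" using fin by simp
  qed
  also have "\<dots> \<le> real n * expect (map_pmf h p) (\<lambda>u. shannon_entropy (cond_pmf p (h -` {u})))"
    by (rule sum_quota_sites_le[where F = "\<lambda>u. shannon_entropy (cond_pmf p (h -` {u}))"])
      (use fin in \<open>auto intro: entropy_nonneg\<close>)
  finally show ?thesis unfolding entropy_conditional_id[OF fin] .
qed

context indexed begin

text \<open>The constant \<open>D\<close> depends on the coupling \<open>r\<close> but not on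
  \<open>n\<close>, so its term is of lower order than \<open>n\<close>.\<close>

lemma tropical_cond_cost:
  fixes X :: "('o, 'm, 's) diagram" and Y :: "('o, 'm, 't) diagram"
  assumes X: "is_diagram G X" and Y: "is_diagram G Y"
    and r: "map_pmf fst r = spc X init_obj" "map_pmf snd r = spc Y init_obj"
  obtains D where "\<And>n. entropy_dist G (tropical_cond G X \<iota> n) (tropical_cond G Y \<iota> n)
     \<le> real n * ((2 * real (card (Obj G)) + 1) * (\<Sum>i\<in>Obj G. obs_cost (from_initial X i) (from_initial Y i) r))
       + D * (sqrt (real n) + 1)"
proof -
  define f where "f = from_initial X"
  define g where "g = from_initial Y"
  define h where "h = map_prod (f \<iota>) (g \<iota>)"
  define rc where "rc = map_pmf h r"
  define C where "C = set_pmf rc"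
  define \<rho> where "\<rho> c = cond_pmf r (h -` {c})" for c
  define P where "P c = map_pmf fst (\<rho> c)" for c
  define Q where "Q c = map_pmf snd (\<rho> c)" for c
  define \<kappa> where "\<kappa> c = (\<Sum>i\<in>Obj G. obs_cost (f i) (g i) (\<rho> c))" for c
  \<comment> \<open>A crude common bound on the entropy of a factor left unmatched; it only enters
    \<open>D\<close>.\<close>
  define B where "B = (\<Sum>c\<in>C. obs_entropy (Obj G) f (P c) + obs_entropy (Obj G) g (Q c))"
  have finr: "finite (set_pmf r)" by (rule finite_coupling) (use r X Y init_obj in \<open>auto simp: finite_spc\<close>)
  have finC: "finite C" by (simp add: C_def rc_def finr)
  have finrc: "finite (set_pmf rc)" using finC by (simp add: C_def)
  have set\<rho>: "set_pmf (\<rho> c) = set_pmf r \<inter> h -` {c}" if "c \<in> C" for c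
    unfolding \<rho>_def using that by (intro set_cond_pmf) (auto simp: C_def rc_def)
  have fin\<rho>: "finite (set_pmf (\<rho> c))" if "c \<in> C" for c using finr by (simp add: set\<rho>[OF that])
  have finPQ: "finite (set_pmf (P c))" "finite (set_pmf (Q c))" if "c \<in> C" for c
    using fin\<rho>[OF that] by (auto simp: P_def Q_def)
  have rcX: "map_pmf fst rc = spc X \<iota>"
    using spc_from_initial[OF X \<iota>] by (simp add: rc_def h_def f_def pmf.map_comp r(1)[symmetric] o_def)
  have rcY: "map_pmf snd rc = spc Y \<iota>"
    using spc_from_initial[OF Y \<iota>] by (simp add: rc_def h_def g_def pmf.map_comp r(2)[symmetric] o_def)
  have condX: "cond_initial X u = bind_pmf (cond_pmf rc (fst -` {u})) P" if "u \<in> set_pmf (spc X \<iota>)" for u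
  proof -
    \<comment> \<open>Fixing \<open>u\<close> is the same as fixing the set of classes whose first
      component is \<open>u\<close>, a union of fibres of \<open>h\<close>.\<close>
    have v: "fst -` (f \<iota> -` {u}) = h -` (fst -` {u})" by (auto simp: h_def)
    have ne: "set_pmf r \<inter> h -` (fst -` {u}) \<noteq> {}"
      using that unfolding rcX[symmetric] rc_def by auto
    have "cond_initial X u = map_pmf fst (cond_pmf r (h -` (fst -` {u})))"
      unfolding cond_initial_def r(1)[symmetric] f_def[symmetric] v[symmetric]
      by (rule cond_map_pmf) (use ne v in auto)
    also have "\<dots> = map_pmf fst (bind_pmf (cond_pmf rc (fst -` {u})) \<rho>)"
      unfolding rc_def \<rho>_def by (subst cond_pmf_vimage[OF ne]) simp
    finally show ?thesis by (simp add: map_bind_pmf P_def[abs_def])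
  qed
  have condY: "cond_initial Y u = bind_pmf (cond_pmf rc (snd -` {u})) Q" if "u \<in> set_pmf (spc Y \<iota>)" for u
  proof -
    have v: "snd -` (g \<iota> -` {u}) = h -` (snd -` {u})" by (auto simp: h_def)
    have ne: "set_pmf r \<inter> h -` (snd -` {u}) \<noteq> {}"
      using that unfolding rcY[symmetric] rc_def by auto
    have "cond_initial Y u = map_pmf snd (cond_pmf r (h -` (snd -` {u})))"
      unfolding cond_initial_def r(2)[symmetric] g_def[symmetric] v[symmetric]
      by (rule cond_map_pmf) (use ne v in auto)
    also have "\<dots> = map_pmf snd (bind_pmf (cond_pmf rc (snd -` {u})) \<rho>)"
      unfolding rc_def \<rho>_def by (subst cond_pmf_vimage[OF ne]) simp
    finally show ?thesis by (simp add: map_bind_pmf Q_def[abs_def])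
  qed
  have setX: "set_pmf (cond_pmf rc (fst -` {u})) = C \<inter> fst -` {u}" if "u \<in> set_pmf (spc X \<iota>)" for u
    unfolding C_def using that unfolding rcX[symmetric] by (intro set_cond_pmf) auto
  have setY: "set_pmf (cond_pmf rc (snd -` {u})) = C \<inter> snd -` {u}" if "u \<in> set_pmf (spc Y \<iota>)" for u
    unfolding C_def using that unfolding rcY[symmetric] by (intro set_cond_pmf) auto
  have \<kappa>0: "0 \<le> \<kappa> c" if "c \<in> C" for c
    unfolding \<kappa>_def by (intro sum_nonneg obs_cost_nonneg fin\<rho> that)
  have \<kappa>c: "coupled (Obj G) (P c) f (Q c) g (\<kappa> c)" for c
    by (rule coupledI[of "\<rho> c"]) (simp_all add: P_def Q_def \<kappa>_def)
  have BPQ: "obs_entropy (Obj G) f (P c) \<le> B" "obs_entropy (Obj G) g (Q c) \<le> B" if "c \<in> C" for c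
  proof -
    have "obs_entropy (Obj G) f (P c) + obs_entropy (Obj G) g (Q c) \<le> B"
      unfolding B_def by (rule member_le_sum[OF that _ finC]) (intro add_nonneg_nonneg obs_entropy_nonneg)
    then show "obs_entropy (Obj G) f (P c) \<le> B" "obs_entropy (Obj G) g (Q c) \<le> B"
      using obs_entropy_nonneg[of "Obj G" f "P c"] obs_entropy_nonneg[of "Obj G" g "Q c"] by linarith+
  qed
  have B0: "0 \<le> B" unfolding B_def by (intro sum_nonneg add_nonneg_nonneg obs_entropy_nonneg)
  have \<kappa>sum: "(\<Sum>c\<in>C. pmf rc c * \<kappa> c) \<le> (\<Sum>i\<in>Obj G. obs_cost (f i) (g i) r)"
  proof -
    have "(\<Sum>c\<in>C. pmf rc c * \<kappa> c) = expect rc \<kappa>" by (simp add: expect_finite[OF finrc] C_def)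
    also have "\<dots> = (\<Sum>i\<in>Obj G. expect rc (\<lambda>c. obs_cost (f i) (g i) (\<rho> c)))"
      unfolding \<kappa>_def by (rule expect_sum[OF finrc])
    also have "\<dots> \<le> (\<Sum>i\<in>Obj G. obs_cost (f i) (g i) r)"
      unfolding rc_def \<rho>_def by (intro sum_mono obs_cost_cond_le finr)
    finally show ?thesis .
  qed
  let ?K = "\<Sum>i\<in>Obj G. obs_cost (f i) (g i) r"
  have cost\<iota>: "obs_cost (f \<iota>) (g \<iota>) r = 2 * shannon_entropy rc - shannon_entropy (map_pmf fst rc) - shannon_entropy (map_pmf snd rc)"
    unfolding obs_cost_def rc_def h_def by (simp add: pmf.map_comp o_def)
  have cost\<iota>_le: "obs_cost (f \<iota>) (g \<iota>) r \<le> ?K"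
    by (rule member_le_sum[OF \<iota> _ finite_Obj]) (rule obs_cost_nonneg[OF finr])
  show thesis
  proof (rule that[of "real (card C) * (2 * B)"])
    fix n
    define S where "S = quota_sites (spc X \<iota>) n"
    define R where "R = quota_sites (spc Y \<iota>) n"
    \<comment> \<open>Independent class labels for the sites on the \<open>X\<close> side: over the
      atom \<open>u\<close>, a class is drawn from \<open>rc\<close> conditioned on first component
      \<open>u\<close>. The labels \<open>MY\<close> on the \<open>Y\<close> side are drawn alike
      over second components.\<close>
    define MX where "MX = Pi_pmf S undefined (\<lambda>s. cond_pmf rc (fst -` {fst s}))"
    define MY where "MY = Pi_pmf R undefined (\<lambda>s. cond_pmf rc (snd -` {fst s}))"
    define NX where "NX c w = real (card {s \<in> S. w s = c})" for c :: "'s \<times> 't" and w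
    define NY where "NY c w = real (card {s \<in> R. w s = c})" for c :: "'s \<times> 't" and w
    define cost where "cost w = (\<Sum>c\<in>C. NX c (fst w) * \<kappa> c + B * \<bar>NX c (fst w) - NY c (snd w)\<bar>)"
      for w :: "('s \<times> nat \<Rightarrow> 's \<times> 't) \<times> ('t \<times> nat \<Rightarrow> 's \<times> 't)"
    have S: "S = quota_sites (map_pmf fst rc) n" and R: "R = quota_sites (map_pmf snd rc) n"
      by (simp_all add: S_def R_def rcX rcY)
    have finS: "finite S" "finite R" by (simp_all add: S_def R_def finite_quota_sites finite_spc[OF _ \<iota>] X Y)
    have S_mem: "fst s \<in> set_pmf (spc X \<iota>)" if "s \<in> S" for s using that unfolding S_def by (rule fst_quota_sites)
    have R_mem: "fst s \<in> set_pmf (spc Y \<iota>)" if "s \<in> R" for s using that unfolding R_def by (rule fst_quota_sites)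
    have finsX: "finite (set_pmf (cond_pmf rc (fst -` {fst s})))" if "s \<in> S" for s
      using finC by (simp add: setX[OF S_mem[OF that]])
    have finsY: "finite (set_pmf (cond_pmf rc (snd -` {fst s})))" if "s \<in> R" for s
      using finC by (simp add: setY[OF R_mem[OF that]])
    have finM: "finite (set_pmf MX)" "finite (set_pmf MY)"
      unfolding MX_def MY_def by (intro finite_set_Pi_pmf finS finsX finsY; assumption)+
    have wX: "w s \<in> C" if "w \<in> set_pmf MX" "s \<in> S" for w s
      using Pi_pmf_memD[OF finS(1) that(1)[unfolded MX_def] that(2)] setX[OF S_mem[OF that(2)]] by auto
    have wY: "w s \<in> C" if "w \<in> set_pmf MY" "s \<in> R" for w s
      using Pi_pmf_memD[OF finS(2) that(1)[unfolded MY_def] that(2)] setY[OF R_mem[OF that(2)]] by auto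
    have match: "coupled_products (Obj G) f g S (\<lambda>s. P (fst w s)) R (\<lambda>l. Q (snd w l)) (cost w)"
      if w: "w \<in> set_pmf (pair_pmf MX MY)" for w
      unfolding cost_def NX_def NY_def
      by (rule coupled_products_matching[OF finS finC]) (use w wX wY finPQ \<kappa>0 \<kappa>c BPQ in auto)
    have "coupled (Obj G) (bind_pmf (pair_pmf MX MY) (\<lambda>w. Pi_pmf S undefined (\<lambda>s. P (fst w s)))) (product_obs f S)
        (bind_pmf (pair_pmf MX MY) (\<lambda>w. Pi_pmf R undefined (\<lambda>l. Q (snd w l)))) (product_obs g R)
        (2 * real (card (Obj G)) * shannon_entropy (pair_pmf MX MY) + expect (pair_pmf MX MY) cost)"
    proof (rule coupled_bind)
      show "finite (set_pmf (pair_pmf MX MY))" using finM by simp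
      fix w assume w: "w \<in> set_pmf (pair_pmf MX MY)"
      show "finite (set_pmf (Pi_pmf S undefined (\<lambda>s. P (fst w s))))"
        using w by (intro finite_set_Pi_pmf finS finPQ wX) auto
      show "finite (set_pmf (Pi_pmf R undefined (\<lambda>l. Q (snd w l))))"
        using w by (intro finite_set_Pi_pmf finS finPQ wY) auto
      show "coupled (Obj G) (Pi_pmf S undefined (\<lambda>s. P (fst w s))) (product_obs f S)
          (Pi_pmf R undefined (\<lambda>l. Q (snd w l))) (product_obs g R) (cost w)"
        using match[OF w] by (simp add: coupled_products_def)
    qed
    \<comment> \<open>Averaging over the labels returns the product of the spaces \<open>X|u\<close>
      exactly: independent labels let the mixture be taken in every coordinate separately.\<close>
    moreover have "bind_pmf (pair_pmf MX MY) (\<lambda>w. Pi_pmf S undefined (\<lambda>s. P (fst w s)))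
        = Pi_pmf S undefined (\<lambda>s. cond_initial X (fst s))"
    proof -
      have "bind_pmf (pair_pmf MX MY) (\<lambda>w. Pi_pmf S undefined (\<lambda>s. P (fst w s)))
         = bind_pmf (map_pmf fst (pair_pmf MX MY)) (\<lambda>w. Pi_pmf S undefined (\<lambda>s. P (w s)))"
        by (simp add: bind_map_pmf)
      also have "\<dots> = Pi_pmf S undefined (\<lambda>s. bind_pmf (cond_pmf rc (fst -` {fst s})) P)"
        unfolding map_fst_pair_pmf MX_def by (rule Pi_pmf_bind[OF finS(1), symmetric])
      also have "\<dots> = Pi_pmf S undefined (\<lambda>s. cond_initial X (fst s))"
        by (intro Pi_pmf_cong refl) (simp add: condX S_mem)
      finally show ?thesis .
    qed
    moreover have "bind_pmf (pair_pmf MX MY) (\<lambda>w. Pi_pmf R undefined (\<lambda>l. Q (snd w l)))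
        = Pi_pmf R undefined (\<lambda>s. cond_initial Y (fst s))"
    proof -
      have "bind_pmf (pair_pmf MX MY) (\<lambda>w. Pi_pmf R undefined (\<lambda>l. Q (snd w l)))
         = bind_pmf (map_pmf snd (pair_pmf MX MY)) (\<lambda>w. Pi_pmf R undefined (\<lambda>s. Q (w s)))"
        by (simp add: bind_map_pmf)
      also have "\<dots> = Pi_pmf R undefined (\<lambda>s. bind_pmf (cond_pmf rc (snd -` {fst s})) Q)"
        unfolding map_snd_pair_pmf MY_def by (rule Pi_pmf_bind[OF finS(2), symmetric])
      also have "\<dots> = Pi_pmf R undefined (\<lambda>s. cond_initial Y (fst s))"
        by (intro Pi_pmf_cong refl) (simp add: condY R_mem)
      finally show ?thesis .
    qed
    ultimately have "coupled_products (Obj G) f g S (\<lambda>s. cond_initial X (fst s)) R (\<lambda>s. cond_initial Y (fst s))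
        (2 * real (card (Obj G)) * shannon_entropy (pair_pmf MX MY) + expect (pair_pmf MX MY) cost)"
      by (simp add: coupled_products_def)
    then have le: "entropy_dist G (tropical_cond G X \<iota> n) (tropical_cond G Y \<iota> n)
        \<le> 2 * real (card (Obj G)) * shannon_entropy (pair_pmf MX MY) + expect (pair_pmf MX MY) cost"
      unfolding S_def R_def f_def g_def
      by (intro entropy_dist_le_coupled is_diagram_tropical_cond X Y) (simp only: coupled_tropical_cond_iff[OF X Y])
    \<comment> \<open>The labels on the two sides have entropies at most \<open>n\<close> H(V|U) and
      \<open>n\<close> H(U|V), which together give \<open>n\<close> times the cost of
      \<open>r\<close> at \<iota>.\<close>
    have "shannon_entropy (pair_pmf MX MY) \<le> real n * obs_cost (f \<iota>) (g \<iota>) r"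
    proof -
      have "shannon_entropy MX \<le> real n * (shannon_entropy rc - shannon_entropy (map_pmf fst rc))"
        unfolding MX_def S by (rule entropy_cond_quota[OF finrc])
      moreover have "shannon_entropy MY \<le> real n * (shannon_entropy rc - shannon_entropy (map_pmf snd rc))"
        unfolding MY_def R by (rule entropy_cond_quota[OF finrc])
      ultimately show ?thesis unfolding cost\<iota> entropy_pair[OF finM] by (simp add: algebra_simps)
    qed
    also have "\<dots> \<le> real n * ?K" by (intro mult_left_mono cost\<iota>_le) simp
    finally have H: "shannon_entropy (pair_pmf MX MY) \<le> real n * ?K" .
    have "expect (pair_pmf MX MY) cost
       = (\<Sum>c\<in>C. expect MX (NX c) * \<kappa> c + B * expect (pair_pmf MX MY) (\<lambda>w. \<bar>NX c (fst w) - NY c (snd w)\<bar>))"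
    proof -
      have fp: "finite (set_pmf (pair_pmf MX MY))" using finM by simp
      have m: "expect (pair_pmf MX MY) (\<lambda>w. NX c (fst w)) = expect MX (NX c)" for c
        using integral_map_pmf[of fst "pair_pmf MX MY" "NX c"] by (simp add: map_fst_pair_pmf)
      show ?thesis
        unfolding cost_def by (simp add: expect_sum[OF fp] expect_add[OF fp] m)
    qed
    also have "\<dots> \<le> (\<Sum>c\<in>C. real n * (pmf rc c * \<kappa> c) + 2 * B * (sqrt (real n) + 1))"
    proof (intro sum_mono add_mono)
      fix c assume c: "c \<in> C"
      then have c': "c \<in> set_pmf rc" by (simp add: C_def)
      have "expect MX (NX c) \<le> real n * pmf rc c"
        using sum_pmf_cond_quota[OF finrc c', of fst n] expect_count[OF finS(1), of "\<lambda>s. cond_pmf rc (fst -` {fst s})" undefined c] finsX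
        unfolding MX_def NX_def S by simp
      from mult_right_mono[OF this \<kappa>0[OF c]]
      show "expect MX (NX c) * \<kappa> c \<le> real n * (pmf rc c * \<kappa> c)" by (simp only: mult.assoc)
      \<comment> \<open>Both counts are compared with \<open>real n * pmf rc c\<close>. On each side
        the fluctuation costs \<open>sqrt (real n)\<close> and the rounding of the quotas costs
        1.\<close>
      have "expect (pair_pmf MX MY) (\<lambda>w. \<bar>NX c (fst w) - NY c (snd w)\<bar>)
         \<le> expect (pair_pmf MX MY) (\<lambda>w. \<bar>NX c (fst w) - real n * pmf rc c\<bar> + \<bar>NY c (snd w) - real n * pmf rc c\<bar>)"
        by (rule expect_mono) (use finM in auto)
      also have "\<dots> = expect (pair_pmf MX MY) (\<lambda>w. \<bar>NX c (fst w) - real n * pmf rc c\<bar>)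
          + expect (pair_pmf MX MY) (\<lambda>w. \<bar>NY c (snd w) - real n * pmf rc c\<bar>)"
        by (rule expect_add) (use finM in auto)
      also have "expect (pair_pmf MX MY) (\<lambda>w. \<bar>NX c (fst w) - real n * pmf rc c\<bar>) = expect MX (\<lambda>w. \<bar>NX c w - real n * pmf rc c\<bar>)"
        using integral_map_pmf[of fst "pair_pmf MX MY" "\<lambda>w. \<bar>NX c w - real n * pmf rc c\<bar>"] by (simp add: map_fst_pair_pmf)
      also have "expect (pair_pmf MX MY) (\<lambda>w. \<bar>NY c (snd w) - real n * pmf rc c\<bar>) = expect MY (\<lambda>w. \<bar>NY c w - real n * pmf rc c\<bar>)"
        using integral_map_pmf[of snd "pair_pmf MX MY" "\<lambda>w. \<bar>NY c w - real n * pmf rc c\<bar>"] by (simp add: map_snd_pair_pmf)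
      also have "expect MX (\<lambda>w. \<bar>NX c w - real n * pmf rc c\<bar>) \<le> sqrt (real (card S)) + 1"
        unfolding MX_def NX_def
        by (rule expect_count_deviation[OF finS(1) finsX]) (use sum_pmf_cond_quota[OF finrc c', of fst n] in \<open>auto simp: S abs_le_iff\<close>)
      also have "expect MY (\<lambda>w. \<bar>NY c w - real n * pmf rc c\<bar>) \<le> sqrt (real (card R)) + 1"
        unfolding MY_def NY_def
        by (rule expect_count_deviation[OF finS(2) finsY]) (use sum_pmf_cond_quota[OF finrc c', of snd n] in \<open>auto simp: R abs_le_iff\<close>)
      also have "sqrt (real (card S)) \<le> sqrt (real n)"
        unfolding S by (intro real_sqrt_le_mono card_quota_sites_le) (simp add: finrc)
      also have "sqrt (real (card R)) \<le> sqrt (real n)"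
        unfolding R by (intro real_sqrt_le_mono card_quota_sites_le) (simp add: finrc)
      finally have "expect (pair_pmf MX MY) (\<lambda>w. \<bar>NX c (fst w) - NY c (snd w)\<bar>) \<le> 2 * (sqrt (real n) + 1)" by simp
      from mult_left_mono[OF this B0]
      show "B * expect (pair_pmf MX MY) (\<lambda>w. \<bar>NX c (fst w) - NY c (snd w)\<bar>) \<le> 2 * B * (sqrt (real n) + 1)" by (simp add: algebra_simps)
    qed
    also have "\<dots> = real n * (\<Sum>c\<in>C. pmf rc c * \<kappa> c) + real (card C) * (2 * B) * (sqrt (real n) + 1)"
      by (simp add: sum.distrib sum_distrib_left)
    also have "\<dots> \<le> real n * ?K + real (card C) * (2 * B) * (sqrt (real n) + 1)"
      by (intro add_right_mono mult_left_mono \<kappa>sum) simp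
    finally have E: "expect (pair_pmf MX MY) cost \<le> real n * ?K + real (card C) * (2 * B) * (sqrt (real n) + 1)" .
    have "2 * real (card (Obj G)) * shannon_entropy (pair_pmf MX MY) \<le> 2 * real (card (Obj G)) * (real n * ?K)"
      by (intro mult_left_mono H) simp
    with le E have "entropy_dist G (tropical_cond G X \<iota> n) (tropical_cond G Y \<iota> n)
        \<le> 2 * real (card (Obj G)) * (real n * ?K) + (real n * ?K + real (card C) * (2 * B) * (sqrt (real n) + 1))"
      by linarith
    then show "entropy_dist G (tropical_cond G X \<iota> n) (tropical_cond G Y \<iota> n)
       \<le> real n * ((2 * real (card (Obj G)) + 1) * (\<Sum>i\<in>Obj G. obs_cost (from_initial X i) (from_initial Y i) r))
         + real (card C) * (2 * B) * (sqrt (real n) + 1)"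
      unfolding f_def g_def by (simp add: algebra_simps)
  qed
qed

end

text \<open>Over each atom the quota for \<open>m + n\<close> is the sum of the two quotas or one
  more. \<open>T\<close> is the shifted copy of the sites for \<open>n\<close>, and \<open>Z\<close>
  holds the possible extra sites, at most one over each atom.\<close>

lemma quota_sites_add:
  assumes fin: "finite (set_pmf p)"
  obtains T Z b where "quota_sites p (m + n) = (quota_sites p m \<union> T) \<union> Z"
    "quota_sites p m \<inter> T = {}" "(quota_sites p m \<union> T) \<inter> Z = {}" "finite T" "finite Z"
    "bij_betw b T (quota_sites p n)" "\<And>s. s \<in> T \<Longrightarrow> fst (b s) = fst s" "card Z \<le> card (set_pmf p)"
proof
  define q where "q k u = nat \<lfloor>real k * pmf p u\<rfloor>" for k u
  have q: "q m u + q n u \<le> q (m + n) u" "q (m + n) u \<le> q m u + q n u + 1" for u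
  proof -
    have "\<lfloor>real m * pmf p u\<rfloor> + \<lfloor>real n * pmf p u\<rfloor> \<le> \<lfloor>real m * pmf p u + real n * pmf p u\<rfloor>"
      "\<lfloor>real m * pmf p u + real n * pmf p u\<rfloor> \<le> \<lfloor>real m * pmf p u\<rfloor> + \<lfloor>real n * pmf p u\<rfloor> + 1"
      by linarith+
    moreover have "0 \<le> \<lfloor>real m * pmf p u\<rfloor>" "0 \<le> \<lfloor>real n * pmf p u\<rfloor>" by simp_all
    moreover have "real (m + n) * pmf p u = real m * pmf p u + real n * pmf p u"
      by (simp add: algebra_simps)
    ultimately show "q m u + q n u \<le> q (m + n) u" "q (m + n) u \<le> q m u + q n u + 1"
      unfolding q_def by linarith+
  qed
  let ?T = "Sigma (set_pmf p) (\<lambda>u. {q m u..<q m u + q n u})"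
  let ?Z = "Sigma (set_pmf p) (\<lambda>u. {q m u + q n u..<q (m + n) u})"
  let ?b = "\<lambda>(u, j). (u, j - q m u)"
  have Q: "quota_sites p k = Sigma (set_pmf p) (\<lambda>u. {..<q k u})" for k
    by (simp add: quota_sites_def q_def)
  have "{..<q (m + n) u} = ({..<q m u} \<union> {q m u..<q m u + q n u}) \<union> {q m u + q n u..<q (m + n) u}" for u
    using q(1)[of u] by auto
  then show "quota_sites p (m + n) = (quota_sites p m \<union> ?T) \<union> ?Z"
    unfolding Q by (auto simp: set_eq_iff)
  show "quota_sites p m \<inter> ?T = {}" "(quota_sites p m \<union> ?T) \<inter> ?Z = {}"
    unfolding Q by auto
  show "finite ?T" "finite ?Z" using fin by auto
  show "bij_betw ?b ?T (quota_sites p n)"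
    unfolding Q by (rule bij_betw_byWitness[where f' = "\<lambda>(u, j). (u, j + q m u)"]) auto
  show "fst (?b s) = fst s" for s by (simp add: split_beta)
  have "card ?Z = (\<Sum>u\<in>set_pmf p. q (m + n) u - (q m u + q n u))"
    using fin by (subst card_SigmaI) auto
  also have "\<dots> \<le> (\<Sum>u\<in>set_pmf p. 1)" by (rule sum_mono) (use q(2) in \<open>simp only: le_diff_conv add.commute\<close>)
  finally show "card ?Z \<le> card (set_pmf p)" by simp
qed

lemma coupled_products_right:
  fixes D :: "'k \<Rightarrow> 's pmf"
  assumes "finite R" "\<And>l. l \<in> R \<Longrightarrow> finite (set_pmf (E l))"
  shows "coupled_products I f g {} D R E (\<Sum>l\<in>R. obs_entropy I g (E l))"
  by (rule coupled_products_sym, rule coupled_products_left) fact+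

lemma sum_obs_entropy_le:
  assumes fin: "finite U" and Z: "finite Z" "fst ` Z \<subseteq> U" "card Z \<le> card U"
  shows "(\<Sum>s\<in>Z. obs_entropy I f (D (fst s))) \<le> real (card U) * (\<Sum>u\<in>U. obs_entropy I f (D u))"
proof -
  have "(\<Sum>s\<in>Z. obs_entropy I f (D (fst s))) \<le> real (card Z) * (\<Sum>u\<in>U. obs_entropy I f (D u))"
    by (rule sum_bounded_above, rule member_le_sum) (use fin Z in \<open>auto intro: obs_entropy_nonneg\<close>)
  also have "\<dots> \<le> real (card U) * (\<Sum>u\<in>U. obs_entropy I f (D u))"
    using Z(3) by (intro mult_right_mono sum_nonneg obs_entropy_nonneg) simp
  finally show ?thesis .
qed

text \<open>The couplings for \<open>m\<close> and \<open>n\<close> run side by side and the extra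
  sites stay unmatched. Their number is bounded by the number of atoms, so the additional cost does
  not depend on \<open>m\<close> and \<open>n\<close>.\<close>

lemma coupled_products_quota_add:
  assumes finp: "finite (set_pmf p)" and finq: "finite (set_pmf q)"
    and D: "\<And>u. u \<in> set_pmf p \<Longrightarrow> finite (set_pmf (D u))"
    and E: "\<And>v. v \<in> set_pmf q \<Longrightarrow> finite (set_pmf (E v))"
    and 1: "coupled_products I f g (quota_sites p m) (\<lambda>s. D (fst s)) (quota_sites q m) (\<lambda>s. E (fst s)) c1"
    and 2: "coupled_products I f g (quota_sites p n) (\<lambda>s. D (fst s)) (quota_sites q n) (\<lambda>s. E (fst s)) c2"
  shows "coupled_products I f g (quota_sites p (m + n)) (\<lambda>s. D (fst s)) (quota_sites q (m + n)) (\<lambda>s. E (fst s))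
    (c1 + c2 + (real (card (set_pmf p)) * (\<Sum>u\<in>set_pmf p. obs_entropy I f (D u))
       + real (card (set_pmf q)) * (\<Sum>v\<in>set_pmf q. obs_entropy I g (E v))))"
proof -
  obtain T Z b where T: "quota_sites p (m + n) = (quota_sites p m \<union> T) \<union> Z"
    "quota_sites p m \<inter> T = {}" "(quota_sites p m \<union> T) \<inter> Z = {}" "finite T" "finite Z"
    "bij_betw b T (quota_sites p n)" "\<And>s. s \<in> T \<Longrightarrow> fst (b s) = fst s" "card Z \<le> card (set_pmf p)"
    using quota_sites_add[OF finp, of m n] by blast
  obtain T' Z' b' where T': "quota_sites q (m + n) = (quota_sites q m \<union> T') \<union> Z'"
    "quota_sites q m \<inter> T' = {}" "(quota_sites q m \<union> T') \<inter> Z' = {}" "finite T'" "finite Z'"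
    "bij_betw b' T' (quota_sites q n)" "\<And>s. s \<in> T' \<Longrightarrow> fst (b' s) = fst s" "card Z' \<le> card (set_pmf q)"
    using quota_sites_add[OF finq, of m n] by blast
  have mp: "fst s \<in> set_pmf p" if "s \<in> (quota_sites p m \<union> T) \<union> Z" for s
    by (rule fst_quota_sites[where n = "m + n"]) (use that in \<open>simp only: T(1)\<close>)
  have mq: "fst s \<in> set_pmf q" if "s \<in> (quota_sites q m \<union> T') \<union> Z'" for s
    by (rule fst_quota_sites[where n = "m + n"]) (use that in \<open>simp only: T'(1)\<close>)
  have fD: "finite (set_pmf (D (fst s)))" if "s \<in> (quota_sites p m \<union> T) \<union> Z" for s
    by (rule D[OF mp[OF that]])
  have fE: "finite (set_pmf (E (fst s)))" if "s \<in> (quota_sites q m \<union> T') \<union> Z'" for s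
    by (rule E[OF mq[OF that]])
  have fS: "finite (quota_sites p k)" "finite (quota_sites q k)" for k
    using finp finq by (auto intro: finite_quota_sites)
  have "coupled_products I f g T (\<lambda>s. D (fst (b s))) (quota_sites q n) (\<lambda>s. E (fst s)) c2"
    by (rule coupled_products_reindex[OF 2 T(4,6)]) (use fS D E in \<open>auto dest: fst_quota_sites\<close>)
  then have "coupled_products I f g T (\<lambda>s. D (fst s)) (quota_sites q n) (\<lambda>s. E (fst s)) c2"
    by (rule coupled_products_cong[THEN iffD1, rotated 2]) (simp_all only: T(7))
  from coupled_products_sym[OF this]
  have "coupled_products I g f T' (\<lambda>s. E (fst (b' s))) T (\<lambda>s. D (fst s)) c2"
    by (rule coupled_products_reindex[OF _ T'(4,6)]) (use fS T(4) D E mp in \<open>auto dest: fst_quota_sites\<close>)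
  from coupled_products_sym[OF this]
  have 3: "coupled_products I f g T (\<lambda>s. D (fst s)) T' (\<lambda>s. E (fst s)) c2"
    by (rule coupled_products_cong[THEN iffD1, rotated 2]) (simp_all only: T'(7))
  have 4: "coupled_products I f g (quota_sites p m \<union> T) (\<lambda>s. D (fst s)) (quota_sites q m \<union> T') (\<lambda>s. E (fst s)) (c1 + c2)"
    by (rule coupled_products_Un[OF 1 3]) (simp_all add: fS T(2,4) T'(2,4) fD fE)
  have "coupled_products I f g Z (\<lambda>s. D (fst s)) {} (\<lambda>s. E (fst s)) (\<Sum>s\<in>Z. obs_entropy I f (D (fst s)))"
    by (rule coupled_products_left) (simp_all add: T(5) fD)
  moreover have "coupled_products I f g {} (\<lambda>s. D (fst s)) Z' (\<lambda>s. E (fst s)) (\<Sum>s\<in>Z'. obs_entropy I g (E (fst s)))"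
    by (rule coupled_products_right) (simp_all add: T'(5) fE)
  ultimately have "coupled_products I f g (Z \<union> {}) (\<lambda>s. D (fst s)) ({} \<union> Z') (\<lambda>s. E (fst s))
      ((\<Sum>s\<in>Z. obs_entropy I f (D (fst s))) + (\<Sum>s\<in>Z'. obs_entropy I g (E (fst s))))"
    by (rule coupled_products_Un) (simp_all add: T(5) T'(5) fD fE)
  then have 5: "coupled_products I f g Z (\<lambda>s. D (fst s)) Z' (\<lambda>s. E (fst s))
      (real (card (set_pmf p)) * (\<Sum>u\<in>set_pmf p. obs_entropy I f (D u))
       + real (card (set_pmf q)) * (\<Sum>v\<in>set_pmf q. obs_entropy I g (E v)))"
    unfolding Un_empty_left Un_empty_right
    by (rule coupled_products_mono)
      (intro add_mono sum_obs_entropy_le finp finq T(5,8) T'(5,8); use mp mq in auto)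
  show ?thesis
    unfolding T(1) T'(1)
    by (rule coupled_products_Un[OF 4 5]) (use T(3) T'(3) in \<open>simp_all add: fS T(4,5) T'(4,5) fD fE\<close>)
qed

section \<open>Existence of the limit and the final estimate\<close>

context indexed begin

lemma entropy_dist_nonneg:
  assumes "is_diagram G X" "is_diagram G Y"
  shows "0 \<le> entropy_dist G X Y"
  unfolding entropy_dist_def
  by (rule cInf_greatest) (use ex_nat_fan[OF cat assms] in \<open>auto simp: kd_def intro!: add_nonneg_nonneg sum_nonneg\<close>)

lemma tropical_cond_convergent:
  assumes X: "is_diagram G X" and Y: "is_diagram G Y"
  shows "convergent (\<lambda>n. 1 / real n * entropy_dist G (tropical_cond G X \<iota> n) (tropical_cond G Y \<iota> n))"
proof -
  define B where "B = real (card (set_pmf (spc X \<iota>))) * (\<Sum>u\<in>set_pmf (spc X \<iota>). obs_entropy (Obj G) (from_initial X) (cond_initial X u))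
       + real (card (set_pmf (spc Y \<iota>))) * (\<Sum>v\<in>set_pmf (spc Y \<iota>). obs_entropy (Obj G) (from_initial Y) (cond_initial Y v))"
  let ?a = "\<lambda>n. entropy_dist G (tropical_cond G X \<iota> n) (tropical_cond G Y \<iota> n)"
  show ?thesis
  proof (rule subadditive_convergent[of ?a B])
    show "0 \<le> ?a n" for n by (intro entropy_dist_nonneg is_diagram_tropical_cond X Y)
    show "0 \<le> B" unfolding B_def by (intro add_nonneg_nonneg mult_nonneg_nonneg sum_nonneg obs_entropy_nonneg) auto
    show "?a (m + n) \<le> ?a m + ?a n + B" for m n
    proof (rule field_le_epsilon)
      fix e :: real assume e: "0 < e"
      \<comment> \<open>Couplings that are optimal up to \<open>e / 2\<close>, since an optimal one
        need not exist.\<close>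
      have *: "coupled_products (Obj G) (from_initial X) (from_initial Y)
          (quota_sites (spc X \<iota>) k) (\<lambda>s. cond_initial X (fst s)) (quota_sites (spc Y \<iota>) k) (\<lambda>s. cond_initial Y (fst s)) (?a k + e / 2)" for k
        unfolding coupled_tropical_cond_iff[OF X Y, symmetric]
        by (rule entropy_dist_less_coupled) (use e in \<open>auto intro: is_diagram_tropical_cond X Y\<close>)
      have "coupled_products (Obj G) (from_initial X) (from_initial Y)
          (quota_sites (spc X \<iota>) (m + n)) (\<lambda>s. cond_initial X (fst s)) (quota_sites (spc Y \<iota>) (m + n)) (\<lambda>s. cond_initial Y (fst s))
          (?a m + e / 2 + (?a n + e / 2) + B)"
        unfolding B_def
        by (rule coupled_products_quota_add[OF finite_spc[OF X \<iota>] finite_spc[OF Y \<iota>]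
              finite_cond_initial[OF X] finite_cond_initial[OF Y] * *])
      then have "?a (m + n) \<le> ?a m + e / 2 + (?a n + e / 2) + B"
        unfolding coupled_tropical_cond_iff[OF X Y, symmetric]
        by (intro entropy_dist_le_coupled is_diagram_tropical_cond X Y)
      then show "?a (m + n) \<le> ?a m + ?a n + B + e" by simp
    qed
  qed
qed

text \<open>After division by \<open>n\<close> the term with \<open>D\<close> tends to zero.
  Convergence of the left side is what gives the \<open>lim\<close> in
  \<open>asymptotic_entropy_dist\<close> its meaning.\<close>

lemma asymptotic_entropy_dist_le_kd:
  assumes X: "is_diagram G X" and Y: "is_diagram G Y" and fan: "is_fan G X Z Y \<phi> \<psi>"
  shows "asymptotic_entropy_dist G (tropical_cond G X \<iota>) (tropical_cond G Y \<iota>)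
    \<le> (2 * real (card (Obj G)) + 1) * kd G X Z Y"
proof -
  obtain r where r: "map_pmf fst r = spc X init_obj" "map_pmf snd r = spc Y init_obj"
    "(\<Sum>i\<in>Obj G. obs_cost (from_initial X i) (from_initial Y i) r) \<le> kd G X Z Y"
    by (rule fan_coupling[OF assms])
  let ?K = "(2 * real (card (Obj G)) + 1) * (\<Sum>i\<in>Obj G. obs_cost (from_initial X i) (from_initial Y i) r)"
  let ?a = "\<lambda>n. entropy_dist G (tropical_cond G X \<iota> n) (tropical_cond G Y \<iota> n)"
  obtain D where D: "\<And>n. ?a n \<le> real n * ?K + D * (sqrt (real n) + 1)"
    by (rule tropical_cond_cost[OF X Y r(1,2)]) (rule that)
  have "(\<lambda>n. 1 / real n * ?a n) \<longlonglongrightarrow> asymptotic_entropy_dist G (tropical_cond G X \<iota>) (tropical_cond G Y \<iota>)"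
    unfolding asymptotic_entropy_dist_def
    using tropical_cond_convergent[OF X Y] by (simp only: convergent_LIMSEQ_iff)
  moreover have "(\<lambda>n. ?K + D * (1 / sqrt (real n) + 1 / real n)) \<longlonglongrightarrow> ?K + D * (0 + 0)"
  proof -
    have "(\<lambda>n. 1 / sqrt (real n)) \<longlonglongrightarrow> 0"
      by (rule tendsto_divide_0[OF tendsto_const filterlim_at_top_imp_at_infinity])
        (rule filterlim_compose[OF sqrt_at_top filterlim_real_sequentially])
    moreover have "(\<lambda>n. 1 / real n) \<longlonglongrightarrow> 0" by (rule lim_const_over_n)
    ultimately show ?thesis by (rule tendsto_add[OF tendsto_const tendsto_mult[OF tendsto_const tendsto_add]])
  qed
  moreover have "\<exists>N. \<forall>n\<ge>N. 1 / real n * ?a n \<le> ?K + D * (1 / sqrt (real n) + 1 / real n)"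
  proof (intro exI[of _ 1] allI impI)
    fix n :: nat assume n: "n \<ge> 1"
    have s: "sqrt (real n) / real n = 1 / sqrt (real n)" using n by (simp add: frac_eq_eq)
    have "1 / real n * ?a n \<le> 1 / real n * (real n * ?K + D * (sqrt (real n) + 1))"
      by (rule mult_left_mono[OF D]) simp
    also have "\<dots> = ?K + D * (sqrt (real n) / real n + 1 / real n)"
      using n by (simp add: field_simps)
    finally show "1 / real n * ?a n \<le> ?K + D * (1 / sqrt (real n) + 1 / real n)" unfolding s .
  qed
  ultimately have "asymptotic_entropy_dist G (tropical_cond G X \<iota>) (tropical_cond G Y \<iota>) \<le> ?K + D * (0 + 0)"
    by (rule LIMSEQ_le)
  also have "\<dots> \<le> (2 * real (card (Obj G)) + 1) * kd G X Z Y"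
    using mult_left_mono[OF r(3), of "2 * real (card (Obj G)) + 1"] by simp
  finally show ?thesis .
qed

end

theorem proposition3p1:
  fixes G :: "('o, 'm) small_cat"
    and X :: "('o, 'm, 's) diagram"
    and Y :: "('o, 'm, 't) diagram"
    and \<iota> :: 'o
  assumes "indexing_category G"
    and "is_diagram G X"
    and "is_diagram G Y"
    and "\<iota> \<in> Obj G"
  shows "asymptotic_entropy_dist G (tropical_cond G X \<iota>) (tropical_cond G Y \<iota>)
           \<le> (2 * real (card (Obj G)) + 1) * entropy_dist G X Y"
proof -
  interpret indexed G \<iota> using assms(1,4) by unfold_locales
  let ?L = "asymptotic_entropy_dist G (tropical_cond G X \<iota>) (tropical_cond G Y \<iota>)"
  let ?c = "2 * real (card (Obj G)) + 1"
  \<comment> \<open>The factor is moved to the left so that the bound for single fans passes to the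
    infimum.\<close>
  have "?L / ?c \<le> entropy_dist G X Y"
    unfolding entropy_dist_def
  proof (rule cInf_greatest)
    show "{kd G X Z Y | (Z :: ('o, 'm, nat) diagram) \<phi> \<psi>. is_fan G X Z Y \<phi> \<psi>} \<noteq> {}"
      using ex_nat_fan[OF cat assms(2,3)] by blast
    fix k assume "k \<in> {kd G X Z Y | (Z :: ('o, 'm, nat) diagram) \<phi> \<psi>. is_fan G X Z Y \<phi> \<psi>}"
    then obtain Z :: "('o, 'm, nat) diagram" and \<phi> \<psi> where "k = kd G X Z Y" "is_fan G X Z Y \<phi> \<psi>"
      by blast
    then have "?L \<le> ?c * k" using asymptotic_entropy_dist_le_kd[OF assms(2,3)] by blast
    then show "?L / ?c \<le> k" by (simp add: divide_le_eq mult.commute)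
  qed
  then show ?thesis by (simp add: divide_le_eq mult.commute)
qed

end
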